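(* $b_g(K_n) = (1+o(1))\, n^2/e$ as $n \to \infty$, where $K_n$ is the complete graph on $n$ vertices and $e$ is the base of the natural logarithm.
   Context: The brushing game on a graph $G$ is played by two players, Max and Min. Initially all vertices are dirty and no vertex contains any brushes. The players alternate turns. On each turn, the player whose turn it is adds one brush to any dirty vertex. After this, if some dirty vertex $v$ has at least as many brushes as it has dirty neighbors, then $v$ fires: one brush is added to each dirty neighbor of $v$, and $v$ itself is marked clean. Vertices continue to fire, sequentially (in an arbitrary order; the order does not affect the outcome), until no more vertices may fire, at which point the turn ends. If at this point all vertices of $G$ are clean, the game ends. The length of the game is the number of brushes placed by the players (the number of turns). Min aims to minimize it, Max aims to maximize it. The game brush number $b_g(G)$ is the length of the game when Min takes the first turn and both players play optimally. *)

theory Defs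
  imports
    "HOL-Library.Landau_Symbols"
    "Graph_Theory.Kuratowski"
begin

text \<open>
  Simple graphs are symmetric loop-free digraphs, as in \<^locale>\<open>graph\<close>; thus \<open>u \<rightarrow>\<^bsub>G\<^esub> v\<close> says
  that \<open>u\<close> and \<open>v\<close> are adjacent.  A position of the game is a pair \<open>(D, b)\<close>, where \<open>D\<close> is the
  set of dirty vertices and \<open>b v\<close> is the number of brushes on \<open>v\<close>.
\<close>

type_synonym 'a position = "'a set \<times> ('a \<Rightarrow> nat)"

definition dirty_nbrs :: "('a, 'b) pre_digraph \<Rightarrow> 'a set \<Rightarrow> 'a \<Rightarrow> 'a set" where
  "dirty_nbrs G D v = {w \<in> D. v \<rightarrow>\<^bsub>G\<^esub> w}"

text \<open>
  Brushes on clean vertices play no further role in the game.  They are reset to 0, so that the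
  position reached by a sequence of firings, and not only its restriction to the dirty vertices,
  is independent of the order of the firings.
\<close>

inductive fires :: "('a, 'b) pre_digraph \<Rightarrow> 'a position \<Rightarrow> 'a position \<Rightarrow> bool"
  for G :: "('a, 'b) pre_digraph" where
  fire: "v \<in> D \<Longrightarrow> card (dirty_nbrs G D v) \<le> b v \<Longrightarrow>
    fires G (D, b)
      (D - {v}, \<lambda>w. if w = v then 0 else if w \<in> dirty_nbrs G D v then b w + 1 else b w)"

definition stable_position :: "('a, 'b) pre_digraph \<Rightarrow> 'a position \<Rightarrow> bool" where
  "stable_position G s \<longleftrightarrow> \<not> (\<exists>t. fires G s t)"

text \<open>The unique stable position reachable from \<open>s\<close> by firings (see \<open>settle_ex1\<close> below).\<close>

definition settle :: "('a, 'b) pre_digraph \<Rightarrow> 'a position \<Rightarrow> 'a position" where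
  "settle G s = (THE t. (fires G)\<^sup>*\<^sup>* s t \<and> stable_position G t)"

definition turn :: "('a, 'b) pre_digraph \<Rightarrow> 'a \<Rightarrow> 'a position \<Rightarrow> 'a position" where
  "turn G v s = settle G (fst s, (snd s)(v := snd s v + 1))"

lemma fires_psubset: "fires G s t \<Longrightarrow> fst t \<subset> fst s"
  by (auto elim!: fires.cases)

lemma fires_rtranclp_cases:
  assumes "(fires G)\<^sup>*\<^sup>* s t"
  shows "t = s \<or> fst t \<subset> fst s"
  using assms by (induction rule: rtranclp_induct) (auto dest: fires_psubset)

lemma fires_diamond:
  assumes "finite (fst s)" "fires G s t" "fires G s u" "t \<noteq> u"
  obtains x where "fires G t x" "fires G u x"
proof -
  obtain D b where s: "s = (D, b)" by (cases s)
  define nxt where "nxt = (\<lambda>D v (b :: 'a \<Rightarrow> nat) w.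
    if w = v then 0 else if w \<in> dirty_nbrs G D v then b w + 1 else b w)"
  have step: "fires G (E, c) (E - {v}, nxt E v c)"
    if "v \<in> E" "card (dirty_nbrs G E v) \<le> c v" for E v c
    unfolding nxt_def using that by (rule fires.fire)
  obtain p where p: "p \<in> D" "card (dirty_nbrs G D p) \<le> b p" "t = (D - {p}, nxt D p b)"
    using assms(2) unfolding s nxt_def by (auto elim!: fires.cases)
  obtain q where q: "q \<in> D" "card (dirty_nbrs G D q) \<le> b q" "u = (D - {q}, nxt D q b)"
    using assms(3) unfolding s nxt_def by (auto elim!: fires.cases)
  have pq: "p \<noteq> q" using assms(4) p(3) q(3) by auto
  have fin: "finite (dirty_nbrs G D v)" for v
    using assms(1) by (simp add: s dirty_nbrs_def)
  have still: "card (dirty_nbrs G (D - {v}) w) \<le> nxt D v b w"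
    if "card (dirty_nbrs G D w) \<le> b w" "v \<noteq> w" for v w
  proof -
    have "card (dirty_nbrs G (D - {v}) w) \<le> card (dirty_nbrs G D w)"
      by (rule card_mono[OF fin]) (auto simp: dirty_nbrs_def)
    also have "\<dots> \<le> nxt D v b w" using that by (auto simp: nxt_def)
    finally show ?thesis .
  qed
  have 1: "fires G t (D - {p} - {q}, nxt (D - {p}) q (nxt D p b))"
    unfolding p(3) by (rule step) (use pq q still[of q p] in auto)
  have 2: "fires G u (D - {q} - {p}, nxt (D - {q}) p (nxt D q b))"
    unfolding q(3) by (rule step) (use pq p still[of p q] in auto)
  have "nxt (D - {p}) q (nxt D p b) = nxt (D - {q}) p (nxt D q b)"
    using pq by (auto simp: nxt_def dirty_nbrs_def fun_eq_iff)
  moreover have "D - {p} - {q} = D - {q} - {p}" by auto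
  ultimately show thesis using that 1 2 by metis
qed

lemma stable_reachable:
  assumes "finite (fst s)"
  shows "\<exists>t. (fires G)\<^sup>*\<^sup>* s t \<and> stable_position G t"
  using assms
proof (induction "card (fst s)" arbitrary: s rule: less_induct)
  case less
  show ?case
  proof (cases "stable_position G s")
    case False
    then obtain t where t: "fires G s t" by (auto simp: stable_position_def)
    have "card (fst t) < card (fst s)" "finite (fst t)"
      using fires_psubset[OF t] less.prems by (auto intro: psubset_card_mono finite_subset)
    from less.hyps[OF this] t show ?thesis by (meson converse_rtranclp_into_rtranclp)
  next
    case True
    then show ?thesis by blast
  qed
qed

lemma stable_unique:
  assumes "finite (fst s)"
    and "(fires G)\<^sup>*\<^sup>* s t" "stable_position G t" "(fires G)\<^sup>*\<^sup>* s u" "stable_position G u"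
  shows "t = u"
  using assms
proof (induction "card (fst s)" arbitrary: s t u rule: less_induct)
  case less
  show ?case
  proof (cases "stable_position G s")
    case True
    then show ?thesis using less.prems by (metis converse_rtranclpE stable_position_def)
  next
    case False
    then have "s \<noteq> t" "s \<noteq> u" using less.prems by auto
    then obtain t' u' where t': "fires G s t'" "(fires G)\<^sup>*\<^sup>* t' t"
      and u': "fires G s u'" "(fires G)\<^sup>*\<^sup>* u' u"
      using less.prems by (metis converse_rtranclpE)
    have dec: "card (fst x) < card (fst s)" "finite (fst x)" if "fires G s x" for x
      using fires_psubset[OF that] less.prems by (auto intro: psubset_card_mono finite_subset)
    show ?thesis
    proof (cases "t' = u'")
      case True
      then show ?thesis using less.hyps[OF dec[OF t'(1)]] t' u' less.prems by blast
    next
      case False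
      obtain x where x: "fires G t' x" "fires G u' x"
        using fires_diamond[OF less.prems(1) t'(1) u'(1) False] .
      have "finite (fst x)"
        using fires_psubset[OF x(1)] dec(2)[OF t'(1)] by (auto intro: finite_subset)
      then obtain y where y: "(fires G)\<^sup>*\<^sup>* x y" "stable_position G y"
        using stable_reachable by blast
      have "t = y"
        using less.hyps[OF dec[OF t'(1)] t'(2) less.prems(3) _ y(2)] x(1) y(1)
        by (meson converse_rtranclp_into_rtranclp)
      moreover have "u = y"
        using less.hyps[OF dec[OF u'(1)] u'(2) less.prems(5) _ y(2)] x(2) y(1)
        by (meson converse_rtranclp_into_rtranclp)
      ultimately show ?thesis by simp
    qed
  qed
qed

lemma settle_ex1:
  assumes "finite (fst s)"
  shows "\<exists>!t. (fires G)\<^sup>*\<^sup>* s t \<and> stable_position G t"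
  using stable_reachable[OF assms] stable_unique[OF assms] by blast

lemma settle_properties:
  assumes "finite (fst s)"
  shows "(fires G)\<^sup>*\<^sup>* s (settle G s)" "stable_position G (settle G s)"
  using theI'[OF settle_ex1[OF assms]] unfolding settle_def by auto

definition missing_brushes :: "'a position \<Rightarrow> nat" where
  "missing_brushes s = (\<Sum>v\<in>fst s. card (fst s) - snd s v)"

lemma turn_decreases:
  assumes fin: "finite (fst s)" and v: "v \<in> fst s"
  shows "card (fst (turn G v s)) < card (fst s) \<or>
    (fst (turn G v s) = fst s \<and> missing_brushes (turn G v s) < missing_brushes s)"
proof -
  define s' where "s' = (fst s, (snd s)(v := snd s v + 1))"
  have t: "turn G v s = settle G s'" by (simp add: turn_def s'_def)
  have fin': "finite (fst s')" using fin by (simp add: s'_def)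
  consider "settle G s' = s'" | "fst (settle G s') \<subset> fst s"
    using fires_rtranclp_cases[OF settle_properties(1)[OF fin', of G]] by (auto simp: s'_def)
  then show ?thesis
  proof cases
    case 1
    then have "stable_position G s'" using settle_properties(2)[OF fin', of G] by simp
    then have "\<not> card (dirty_nbrs G (fst s) v) \<le> snd s v + 1"
      using fires.fire[of v "fst s" G "(snd s)(v := snd s v + 1)"] v
      by (auto simp: stable_position_def s'_def)
    moreover have "card (dirty_nbrs G (fst s) v) \<le> card (fst s)"
      by (rule card_mono[OF fin]) (auto simp: dirty_nbrs_def)
    ultimately have lt: "snd s v < card (fst s)" by simp
    have "missing_brushes s' < missing_brushes s"
      unfolding missing_brushes_def s'_def fst_conv snd_conv
      by (rule sum_strict_mono_ex1[OF fin]) (use v lt in \<open>auto intro!: bexI[of _ v]\<close>)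
    with 1 show ?thesis by (simp add: t) (simp add: s'_def)
  next
    case 2
    then show ?thesis using psubset_card_mono[OF fin] by (simp add: t)
  qed
qed

datatype player = Player_Min | Player_Max

text \<open>
  The number of turns still to be played under optimal play from a position, when the given player
  is to move: the minimax value of the remaining play, by backward induction over the finite game
  tree.  Termination is proved below; the finiteness guard only makes the function total, as the
  set of dirty vertices of a finite graph is finite.
\<close>

function game_length :: "('a, 'b) pre_digraph \<Rightarrow> player \<Rightarrow> 'a position \<Rightarrow> nat" where
  "game_length G p s =
    (if fst s = {} \<or> infinite (fst s) then 0
     else case p of
       Player_Min \<Rightarrow> 1 + (MIN v\<in>fst s. game_length G Player_Max (turn G v s))
     | Player_Max \<Rightarrow> 1 + (MAX v\<in>fst s. game_length G Player_Min (turn G v s)))"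
  by pat_completeness auto

termination
  by (relation "inv_image (less_than <*lex*> less_than)
      (\<lambda>(G, p, s). (card (fst s), missing_brushes s))")
    (use turn_decreases in fastforce)+

text \<open>
  Unfolding \<^const>\<open>game_length\<close> creates new instances of itself, so it is not a simp rule.
\<close>

declare game_length.simps [simp del]

definition game_brush_number :: "('a, 'b) pre_digraph \<Rightarrow> nat" (\<open>b\<^sub>g\<close>) where
  "b\<^sub>g G = game_length G Player_Min (verts G, \<lambda>_. 0)"

end

theory Submission
  imports Defs
begin

text \<open>
  The deficit of a dirty vertex is the number of brushes that it lacks to fire.  On a complete
  graph a brush lowers one deficit by 1, and every firing lowers all other deficits by 2.  Min wants
  to exhaust single vertices, since each firing is a gift of two brushes to everybody else; Max
  wants to keep the deficits equal, since then no vertex is cheap.  Suppose that both do so, and let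
  \<open>l\<close> be the common deficit when \<open>u\<close> vertices are dirty.  The next firing takes \<open>2 l\<close> turns; the \<open>l\<close>
  brushes of Max are spread over \<open>u\<close> vertices and the firing costs everybody 2, so
  \<open>dl / du = 2 + l / u\<close>.  With \<open>l = n\<close> at \<open>u = n\<close> this gives \<open>l = u (1 + 2 ln (u / n))\<close>, so that
  \<open>2 ln u - l / u\<close> is an invariant.  At \<open>u = n / sqrt e\<close> the deficit is 0 and everything fires; the
  number of turns until then is the integral of \<open>2 l\<close>, namely \<open>n\<^sup>2 / e\<close>.

  For the upper bound Min keeps brushing one vertex until something fires.  Whatever Max
  does, only the number \<open>m\<close> of dirty vertices and the sum \<open>S\<close> of their deficits matter: the
  smallest deficit is at most \<open>S / m\<close>, so a phase takes at most \<open>2 S / m\<close> turns.  The value \<open>val m S\<close>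
  of the balanced game dominates such a phase (\<open>val_phase\<close>), and cascades of several firings, in
  which brushes are wasted, do not help Max (\<open>val_cascade\<close>).  Every fired vertex costs a bounded
  error, so the game has at most \<open>n\<^sup>2 / e + O(n)\<close> turns.

  For the lower bound Max always brushes a vertex of the largest deficit.  Stack the deficit of each
  vertex on top of twice the number of vertices already clean: then brushes take single cells off
  these columns, and a vertex fires when its column is under a water level that rises by 2 with every
  firing.  Max works row by row from the top, and needs one turn less in a row for every column
  that is already lower.  The number of cells that Min has dug below the current row is bounded in
  terms of the number of lower columns, because a column can be dug only down to the water.  This turns the
  invariant \<open>loss\<close> into a recursion over the rows (\<open>paced_next_row\<close>), a discrete form of the
  differential equation above, which says how low Max's row has to get before the game can end.  Finally
  the row \<open>r\<close> of Max at the end determines the length: all \<open>n\<close> columns have been lowered to \<open>r\<close>, and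
  those that fire in turn had to be dug down to the water, which makes \<open>(n - r / 2)\<^sup>2\<close> cells up to \<open>O(n)\<close>
  (\<open>paid_needed\<close>).
\<close>

section \<open>Positions on complete graphs\<close>

text \<open>
  An integer, since a vertex that is about to fire in a cascade may have been pushed below 0.
\<close>

definition deficit :: "'a position \<Rightarrow> 'a \<Rightarrow> int" where
  "deficit s v = int (card (fst s)) - 1 - int (snd s v)"

lemma dirty_nbrs_complete:
  assumes "complete_digraph n G" "D \<subseteq> verts G" "v \<in> D"
  shows "dirty_nbrs G D v = D - {v}"
  using assms unfolding complete_digraph_def dirty_nbrs_def by auto

lemma finite_dirty_complete:
  assumes "complete_digraph n G" "D \<subseteq> verts G"
  shows "finite D" "card D \<le> n"
proof -
  interpret graph G using assms(1) by (simp add: complete_digraph_def)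
  show "finite D" using assms(2) finite_verts by (rule finite_subset)
  show "card D \<le> n"
    using card_mono[OF finite_verts assms(2)] assms(1) by (simp add: complete_digraph_def)
qed

text \<open>
  Every dirty vertex has all other dirty vertices as dirty neighbours, so the firing condition
  and the effect of a firing depend on the adjacency relation only through the number of dirty
  vertices.
\<close>

lemma fires_complete_iff:
  assumes "complete_digraph n G" "fst s \<subseteq> verts G"
  shows "fires G s t \<longleftrightarrow> (\<exists>v\<in>fst s. deficit s v \<le> 0 \<and>
    t = (fst s - {v}, \<lambda>w. if w = v then 0 else if w \<in> fst s then snd s w + 1 else snd s w))"
proof -
  obtain D b where s: "s = (D, b)" by (cases s)
  have D: "D \<subseteq> verts G" using assms(2) s by simp
  have fin: "finite D" using finite_dirty_complete[OF assms(1) D] by simp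
  have cond: "card (dirty_nbrs G D v) \<le> b v \<longleftrightarrow> deficit (D, b) v \<le> 0" if "v \<in> D" for v
  proof -
    have "card D > 0" using that fin card_gt_0_iff by blast
    then show ?thesis
      using that by (auto simp: dirty_nbrs_complete[OF assms(1) D that] deficit_def)
  qed
  have res: "(\<lambda>w. if w = v then 0 else if w \<in> dirty_nbrs G D v then b w + 1 else b w)
      = (\<lambda>w. if w = v then 0 else if w \<in> D then b w + 1 else b w)" if "v \<in> D" for v
    by (auto simp: dirty_nbrs_complete[OF assms(1) D that])
  have "fires G (D, b) t \<longleftrightarrow> (\<exists>v\<in>D. deficit (D, b) v \<le> 0 \<and>
    t = (D - {v}, \<lambda>w. if w = v then 0 else if w \<in> D then b w + 1 else b w))" (is "_ \<longleftrightarrow> ?R")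
  proof
    assume "fires G (D, b) t"
    then show ?R
    proof cases
      case (fire v)
      then have v: "v \<in> D" by simp
      show ?thesis by (rule bexI[OF _ v]) (use fire cond[OF v] res[OF v] in simp)
    qed
  next
    assume ?R
    then obtain v where v: "v \<in> D" "deficit (D, b) v \<le> 0"
      and t: "t = (D - {v}, \<lambda>w. if w = v then 0 else if w \<in> D then b w + 1 else b w)"
      by auto
    show "fires G (D, b) t"
      unfolding t res[OF v(1), symmetric] by (rule fires.fire) (use v cond in auto)
  qed
  then show ?thesis unfolding s fst_conv snd_conv .
qed

lemma stable_deficit_pos:
  assumes "complete_digraph n G" "fst s \<subseteq> verts G" "stable_position G s" "v \<in> fst s"
  shows "deficit s v \<ge> 1"
proof (rule ccontr)
  assume "\<not> deficit s v \<ge> 1"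
  then have "\<exists>t. fires G s t" unfolding fires_complete_iff[OF assms(1,2)] using assms(4)
    by (intro exI bexI[of _ v] conjI refl) simp_all
  then show False using assms(3) by (simp add: stable_position_def)
qed

lemma
  assumes "complete_digraph n G" "fst s \<subseteq> verts G" "fires G s t"
  shows fires_vertex: "\<exists>v\<in>fst s. deficit s v \<le> 0 \<and> fst t = fst s - {v}"
    and fires_card: "card (fst s) = card (fst t) + 1"
    and fires_brushes: "w \<in> fst t \<Longrightarrow> snd t w = snd s w + 1"
    and fires_deficit: "w \<in> fst t \<Longrightarrow> deficit t w = deficit s w - 2"
proof -
  obtain v where v: "v \<in> fst s" "deficit s v \<le> 0"
    and t: "t = (fst s - {v}, \<lambda>w. if w = v then 0 else if w \<in> fst s then snd s w + 1 else snd s w)"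
    using assms(3) unfolding fires_complete_iff[OF assms(1,2)] by blast
  have fin: "finite (fst s)" using finite_dirty_complete[OF assms(1,2)] by simp
  have D: "fst t = fst s - {v}" by (simp add: t)
  show "\<exists>v\<in>fst s. deficit s v \<le> 0 \<and> fst t = fst s - {v}"
    by (rule bexI[OF _ v(1)]) (simp add: v D)
  show c: "card (fst s) = card (fst t) + 1"
    unfolding D Suc_eq_plus1[symmetric] by (rule card.remove[OF fin v(1)])
  show b: "snd t w = snd s w + 1" if "w \<in> fst t" for w
    using that by (simp add: t)
  show "deficit t w = deficit s w - 2" if "w \<in> fst t" for w
    using b[OF that] c by (simp add: deficit_def)
qed

text \<open>
  The part of a turn that precedes the firings.
\<close>

definition place :: "'a \<Rightarrow> 'a position \<Rightarrow> 'a position" where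
  "place v s = (fst s, (snd s)(v := snd s v + 1))"

lemma fst_place [simp]: "fst (place v s) = fst s"
  by (simp add: place_def)

lemma snd_place: "snd (place v s) w = snd s w + (if w = v then 1 else 0)"
  by (simp add: place_def)

lemma deficit_place: "deficit (place v s) w = deficit s w - (if w = v then 1 else 0)"
  by (simp add: deficit_def snd_place)

lemma turn_reachable:
  assumes "complete_digraph n G" "fst s \<subseteq> verts G"
  shows "(fires G)\<^sup>*\<^sup>* (place v s) (turn G v s)" "stable_position G (turn G v s)"
  using settle_properties[of "place v s" G] finite_dirty_complete[OF assms]
  by (simp_all add: turn_def place_def)

text \<open>
  How the firings of a turn proceed is irrelevant below: what is used of a turn are properties
  that the brush establishes and that each single firing preserves.
\<close>

lemma turn_invariant:
  assumes "complete_digraph n G" "fst s \<subseteq> verts G"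
    and "P (place v s)"
    and "\<And>s t. fst s \<subseteq> verts G \<Longrightarrow> P s \<Longrightarrow> fires G s t \<Longrightarrow> P t"
  shows "fst (turn G v s) \<subseteq> verts G \<and> P (turn G v s)"
  using turn_reachable(1)[OF assms(1,2)]
proof (induction rule: rtranclp_induct)
  case base
  then show ?case using assms by simp
next
  case (step y z)
  have "fst z \<subset> fst y" by (rule fires_psubset[OF step.hyps(2)])
  moreover have "P z" using step.IH step.hyps(2) assms(4)[of y z] by simp
  ultimately show ?case using step.IH by auto
qed

lemma turn_complete:
  assumes K: "complete_digraph n G" and D: "fst s \<subseteq> verts G"
  shows "fst (turn G v s) \<subseteq> fst s"
    and "w \<in> fst (turn G v s) \<Longrightarrow>
      snd (turn G v s) w + card (fst (turn G v s)) = snd (place v s) w + card (fst s)"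
proof -
  define P where "P x \<longleftrightarrow> fst x \<subseteq> fst s \<and>
    (\<forall>w\<in>fst x. snd x w + card (fst x) = snd (place v s) w + card (fst s))" for x :: "'a position"
  have P: "P (turn G v s)"
  proof (rule conjunct2[OF turn_invariant[OF K D]])
    show "P (place v s)" by (simp add: P_def)
    fix x y assume x: "fst x \<subseteq> verts G" "P x" and f: "fires G x y"
    obtain u where u: "fst y = fst x - {u}" using fires_vertex[OF K x(1) f] by blast
    have "snd y w + card (fst y) = snd (place v s) w + card (fst s)" if "w \<in> fst y" for w
    proof -
      have "w \<in> fst x" using that u by simp
      then have "snd x w + card (fst x) = snd (place v s) w + card (fst s)"
        using x(2) unfolding P_def by blast
      then show ?thesis
        using fires_brushes[OF K x(1) f that] fires_card[OF K x(1) f] by linarith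
    qed
    moreover have "fst y \<subseteq> fst s" using x(2) u unfolding P_def by blast
    ultimately show "P y" unfolding P_def by blast
  qed
  then show "fst (turn G v s) \<subseteq> fst s" unfolding P_def by (rule conjunct1)
  show "snd (turn G v s) w + card (fst (turn G v s)) = snd (place v s) w + card (fst s)"
    if "w \<in> fst (turn G v s)"
    using P that unfolding P_def by (elim conjE) (rule bspec)
qed

section \<open>Optimal play\<close>

lemma game_length_empty: "fst s = {} \<Longrightarrow> game_length G p s = 0"
  by (subst game_length.simps) simp

lemma game_length_Min_le:
  assumes "finite (fst s)" "v \<in> fst s"
  shows "game_length G Player_Min s \<le> 1 + game_length G Player_Max (turn G v s)"
  using assms by (subst game_length.simps) (auto intro!: Min_le)

lemma game_length_Max_ge:
  assumes "finite (fst s)" "v \<in> fst s"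
  shows "1 + game_length G Player_Min (turn G v s) \<le> game_length G Player_Max s"
  using assms by (subst (2) game_length.simps) (auto intro!: Max_ge)

lemma game_length_Min_attained:
  assumes "finite (fst s)" "fst s \<noteq> {}"
  obtains v where "v \<in> fst s"
    "game_length G Player_Min s = 1 + game_length G Player_Max (turn G v s)"
proof -
  let ?f = "\<lambda>v. game_length G Player_Max (turn G v s)"
  have "Min (?f ` fst s) \<in> ?f ` fst s" using assms by (intro Min_in) auto
  then obtain v where "v \<in> fst s" "Min (?f ` fst s) = ?f v" by blast
  moreover have "game_length G Player_Min s = 1 + Min (?f ` fst s)"
    using assms by (subst game_length.simps) auto
  ultimately show thesis using that by auto
qed

lemma game_length_Max_attained:
  assumes "finite (fst s)" "fst s \<noteq> {}"
  obtains v where "v \<in> fst s"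
    "game_length G Player_Max s = 1 + game_length G Player_Min (turn G v s)"
proof -
  let ?f = "\<lambda>v. game_length G Player_Min (turn G v s)"
  have "Max (?f ` fst s) \<in> ?f ` fst s" using assms by (intro Max_in) auto
  then obtain v where "v \<in> fst s" "Max (?f ` fst s) = ?f v" by blast
  moreover have "game_length G Player_Max s = 1 + Max (?f ` fst s)"
    using assms by (subst game_length.simps) auto
  ultimately show thesis using that by auto
qed

text \<open>
  Induction along the game tree, for statements about both players at once.
\<close>

lemma play_induct [consumes 1, case_names play]:
  assumes "finite (fst s)"
    and step: "\<And>s. finite (fst s) \<Longrightarrow> (\<And>v. v \<in> fst s \<Longrightarrow> P (turn G v s)) \<Longrightarrow> P s"
  shows "P s"
proof -
  define m where "m = (\<lambda>s :: 'a position. (card (fst s), missing_brushes s))"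
  have "wf (inv_image (less_than <*lex*> less_than) m)" by (intro wf_inv_image wf_lex_prod) auto
  then have "finite (fst s) \<longrightarrow> P s"
  proof (induction s rule: wf_induct_rule)
    case (less s)
    show ?case
    proof
      assume fin: "finite (fst s)"
      show "P s"
      proof (rule step[OF fin])
        fix v assume v: "v \<in> fst s"
        let ?s = "(fst s, (snd s)(v := snd s v + 1))"
        have r: "(fires G)\<^sup>*\<^sup>* ?s (turn G v s)"
          unfolding turn_def using fin by (intro settle_properties) simp
        have "fst (turn G v s) \<subseteq> fst s" using fires_rtranclp_cases[OF r] by auto
        then have "finite (fst (turn G v s))" using fin by (rule finite_subset)
        moreover have "(turn G v s, s) \<in> inv_image (less_than <*lex*> less_than) m"
          using turn_decreases[OF fin v, of G] by (auto simp: m_def)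
        ultimately show "P (turn G v s)" using less by blast
      qed
    qed
  qed
  with assms(1) show ?thesis by blast
qed

section \<open>The length of balanced play\<close>

text \<open>
  If \<open>m\<close> dirty vertices have equal deficits with sum \<open>S\<close>, then \<open>val m S\<close> is the length of the
  balanced continuous game: solving \<open>dl / du = 2 + l / u\<close> from \<open>l = S / m\<close>, \<open>u = m\<close> and
  integrating \<open>2 l\<close> down to \<open>l = 0\<close> gives \<open>S - m\<^sup>2 + m\<^sup>2 exp (- S / m\<^sup>2)\<close>. The function \<open>phi\<close> is
  the case \<open>m = 1\<close>, extended by 0 to a differentiable function on the reals.
\<close>

definition phi :: "real \<Rightarrow> real" where
  "phi x = (if x \<le> 0 then 0 else x - 1 + exp (- x))"

definition val :: "real \<Rightarrow> real \<Rightarrow> real" where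
  "val m S = m\<^sup>2 * phi (S / m\<^sup>2)"

lemma phi_nonneg: "0 \<le> phi x"
  using exp_ge_add_one_self[of "- x"] by (auto simp: phi_def)

lemma phi_diff:
  assumes "x \<le> y"
  shows "phi x \<le> phi y" "phi y \<le> phi x + (y - x)"
proof -
  have *: "x - 1 + exp (- x) \<le> y - 1 + exp (- y)" if "0 \<le> x" "x \<le> y" for x y :: real
  proof -
    have "exp (- x) * (1 - exp (-(y - x))) \<le> 1 * (y - x)"
      by (rule mult_mono) (use that exp_ge_add_one_self[of "-(y - x)"] in \<open>auto simp: algebra_simps\<close>)
    moreover have "exp (- x) * exp (-(y - x)) = exp (- y)" by (simp flip: exp_add)
    ultimately show ?thesis by (simp add: algebra_simps)
  qed
  show "phi x \<le> phi y" using *[of x y] *[of 0 y] assms by (auto simp: phi_def)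
  show "phi y \<le> phi x + (y - x)"
  proof (cases "x \<le> 0 \<and> 0 < y")
    case True
    then have "exp (- y) \<le> 1" by simp
    with True show ?thesis by (simp add: phi_def del: exp_le_one_iff)
  next
    case False
    moreover have "exp (- y) \<le> exp (- x)" using assms by simp
    ultimately show ?thesis using assms by (auto simp: phi_def)
  qed
qed

lemma val_nonneg: "0 \<le> val m S"
  by (simp add: val_def phi_nonneg)

lemma val_mono: "S \<le> T \<Longrightarrow> val m S \<le> val m T"
  unfolding val_def by (intro mult_left_mono phi_diff divide_right_mono) auto

text \<open>
  The derivative in \<open>S\<close> lies between 0 and 1: lowering the total deficit by brushes never
  shortens the remaining game by more than the number of these brushes. Hence prolonging a phase
  never hurts Max.
\<close>

lemma val_lipschitz:
  assumes "S \<le> T"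
  shows "val m T \<le> val m S + (T - S)"
proof (cases "m = 0")
  case False
  have "m\<^sup>2 * phi (T / m\<^sup>2) \<le> m\<^sup>2 * (phi (S / m\<^sup>2) + (T / m\<^sup>2 - S / m\<^sup>2))"
    by (intro mult_left_mono phi_diff divide_right_mono assms) auto
  with False show ?thesis by (simp add: val_def algebra_simps)
qed (use assms in \<open>simp add: val_def\<close>)

text \<open>
  A phase of \<open>2 S / m\<close> turns, which ends with a firing that takes 2 off each of the \<open>m - 1\<close>
  other deficits, is balanced play. The continuous value is invariant under it, so only a second
  order error remains, which the constant 8 covers.
\<close>

lemma val_phase:
  fixes m :: nat
  assumes "m \<ge> 1" "0 \<le> S" "S \<le> (real m)\<^sup>2"
  shows "2 * S / m + val (real m - 1) (S - 2 * S / m - 2 * (real m - 1)) \<le> val m S + 8"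
proof -
  define s where "s = S / (real m)\<^sup>2"
  define p where "p = real m - 1"
  have S: "S = s * (real m)\<^sup>2" "2 * S / m = 2 * s * m"
    using assms by (simp_all add: s_def power2_eq_square)
  have s: "0 \<le> s" "s \<le> 1" using assms by (simp_all add: s_def)
  have mp: "real m = p + 1" by (simp add: p_def)
  have sm: "s * m \<le> m" using s by (simp add: mult_left_le_one_le)
  show ?thesis
  proof (cases "p = 0 \<or> s \<le> 2 / p")
    case True
    \<comment> \<open>After this phase the total deficit is gone: the phase itself takes at most 8 turns.\<close>
    have "val p (S - 2 * S / m - 2 * p) = 0 \<and> s * m \<le> 4"
    proof (cases "p = 0")
      case True
      then show ?thesis using sm mp by (simp add: val_def)
    next
      case False
      then have p: "p \<ge> 1" using assms by (simp add: p_def)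
      have sp: "s * p \<le> 2" using True False p by (simp add: field_simps)
      have "s * m \<le> 4" using sp s mp by (simp add: algebra_simps)
      moreover have "S - 2 * S / m - 2 * p \<le> 0"
      proof -
        have "S - 2 * S / m - 2 * p = (s * p) * p - s - 2 * p"
          unfolding S(2) unfolding S(1) mp by (simp add: algebra_simps power2_eq_square)
        also have "\<dots> \<le> 2 * p - s - 2 * p" using mult_right_mono[OF sp, of p] p by simp
        finally show ?thesis using s by simp
      qed
      then have "val p (S - 2 * S / m - 2 * p) = 0"
        by (simp add: val_def phi_def divide_le_0_iff)
      ultimately show ?thesis by simp
    qed
    then show ?thesis using val_nonneg[of m S] S by (simp add: p_def)
  next
    case False
    then have p: "p \<ge> 1" using assms by (simp add: p_def)
    define h where "h = 2 / p"
    have "2 < s * p" using False p by (simp add: field_simps)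
    also have "s * p \<le> p" using s p by (simp add: mult_left_le_one_le)
    finally have p2: "2 < p" .
    have h: "0 < h" "h < s" "h \<le> 1" "p * h = 2" "p\<^sup>2 * h = 2 * p" "p\<^sup>2 * h\<^sup>2 = 4"
      using False p2 s by (auto simp: h_def field_simps power2_eq_square)
    have e: "0 < exp (- s)" "exp (- s) \<le> 1" using s by auto
    have "S - 2 * S / m - 2 * p = p\<^sup>2 * (s - h) - s"
      unfolding S(2) unfolding S(1) using h(5) mp by (simp add: algebra_simps power2_eq_square)
    moreover have "(p\<^sup>2 * (s - h) - s) / p\<^sup>2 \<le> s - h"
      using p s by (simp add: diff_divide_distrib)
    ultimately have "(S - 2 * S / m - 2 * p) / p\<^sup>2 \<le> s - h" by simp
    then have "val p (S - 2 * S / m - 2 * p) \<le> p\<^sup>2 * phi (s - h)"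
      unfolding val_def by (intro mult_left_mono phi_diff) auto
    also have "\<dots> = p\<^sup>2 * (s - h - 1 + exp (- s) * exp h)"
      using h by (simp add: phi_def flip: exp_add)
    also have "\<dots> \<le> p\<^sup>2 * (s - h - 1 + exp (- s) * (1 + h + h\<^sup>2))"
      using exp_bound[of h] h e by (intro mult_left_mono add_left_mono) auto
    also have "\<dots> = p\<^sup>2 * (s - 1) - 2 * p + exp (- s) * (p\<^sup>2 + 2 * p + 4)"
      using h(5,6) by (simp add: algebra_simps)
    finally have 1: "val p (S - 2 * S / m - 2 * p)
      \<le> p\<^sup>2 * (s - 1) - 2 * p + exp (- s) * (p\<^sup>2 + 2 * p + 4)" .
    have "val m S = (p + 1)\<^sup>2 * (s - 1 + exp (- s))"
      using assms h by (simp add: val_def phi_def s_def mp) 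
    also have "\<dots> = p\<^sup>2 * (s - 1) + (2 * p + 1) * (s - 1) + exp (- s) * (p\<^sup>2 + 2 * p + 1)"
      by (simp add: algebra_simps power2_eq_square)
    finally have 2: "val m S = \<dots>" .
    have "2 * s * m = 2 * s * p + 2 * s" by (simp add: mp algebra_simps)
    then have "2 * S / m + (p\<^sup>2 * (s - 1) - 2 * p + exp (- s) * (p\<^sup>2 + 2 * p + 4))
        = val m S + 1 + s + 3 * exp (- s)"
      unfolding 2 S(2) by (simp add: algebra_simps)
    then show ?thesis using 1 s e unfolding p_def[symmetric] by linarith
  qed
qed

text \<open>
  Suppose that \<open>g\<close> vertices fire at once and leave \<open>m\<close> vertices with total deficit \<open>Y\<close>. Such a
  cascade wastes brushes on vertices that fire anyway, so \<open>Y\<close> can be larger than after \<open>g\<close>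
  separate firings. The normalized deficit \<open>Y / m\<^sup>2\<close> still does not grow; the reason is that a
  surviving deficit is below \<open>m - g\<close>, because each of the \<open>m\<close> survivors has received \<open>g\<close>
  brushes.
\<close>

lemma val_cascade:
  fixes m g :: real
  assumes "m \<ge> 1" "g \<ge> 0" "Y \<le> m * (m - g)" "Y + 2 * g * m \<le> S"
  shows "val m Y \<le> val (m + g) S"
proof -
  have "0 \<le> m * g\<^sup>2 * (m + g)" using assms by simp
  also have "m * g\<^sup>2 * (m + g) = 2 * g * m * (m\<^sup>2 - m * (m - g)) - m * (m - g) * g\<^sup>2"
    by (simp add: algebra_simps power2_eq_square)
  also have "\<dots> \<le> 2 * g * m * (m\<^sup>2 - Y) - Y * g\<^sup>2"
  proof -
    have "2 * g * m * (m\<^sup>2 - m * (m - g)) \<le> 2 * g * m * (m\<^sup>2 - Y)"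
      using assms by (intro mult_left_mono) auto
    moreover have "Y * g\<^sup>2 \<le> m * (m - g) * g\<^sup>2" using assms by (intro mult_right_mono) auto
    ultimately show ?thesis by simp
  qed
  also have "\<dots> = (Y + 2 * g * m) * m\<^sup>2 - Y * (m + g)\<^sup>2"
    by (simp add: algebra_simps power2_eq_square)
  also have "\<dots> \<le> S * m\<^sup>2 - Y * (m + g)\<^sup>2" using assms by (intro diff_mono mult_right_mono) auto
  finally have "Y * (m + g)\<^sup>2 \<le> S * m\<^sup>2" by simp
  then have "Y / m\<^sup>2 \<le> S / (m + g)\<^sup>2" using assms by (simp add: divide_simps)
  moreover have "m\<^sup>2 \<le> (m + g)\<^sup>2" using assms by (intro power_mono) auto
  ultimately show ?thesis
    unfolding val_def by (intro mult_mono phi_diff phi_nonneg) auto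
qed

section \<open>Min exhausts one vertex at a time\<close>

definition total_deficit :: "'a position \<Rightarrow> int" where
  "total_deficit s = (\<Sum>v\<in>fst s. deficit s v)"

text \<open>
  The value of a phase that ends after \<open>2 d\<close> further turns. If Min is to move and works on a
  vertex of deficit \<open>d\<close>, this is exactly the remaining length of the phase; if Max is to move,
  the phase has one turn more, which is the argument \<open>d + 1 / 2\<close>.
\<close>

definition phase_bound :: "real \<Rightarrow> real \<Rightarrow> real \<Rightarrow> real" where
  "phase_bound m S d = 2 * d + val (m - 1) (S - 2 * d - 2 * (m - 1))"

lemma phase_bound_mono: "d \<le> d' \<Longrightarrow> phase_bound m S d \<le> phase_bound m S d'"
  using val_lipschitz[of "S - 2 * d' - 2 * (m - 1)" "S - 2 * d - 2 * (m - 1)" "m - 1"]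
  by (simp add: phase_bound_def)

lemma phase_bound_half: "phase_bound m S (d + 1 / 2) \<le> phase_bound m S d + 1"
  using val_mono[of "S - 2 * (d + 1 / 2) - 2 * (m - 1)" "S - 2 * d - 2 * (m - 1)" "m - 1"]
  by (simp add: phase_bound_def)

lemma exists_le_average:
  fixes f :: "'a \<Rightarrow> int"
  assumes "finite A" "A \<noteq> {}"
  obtains w where "w \<in> A" "real_of_int (f w) \<le> real_of_int (\<Sum>v\<in>A. f v) / card A"
proof (rule ccontr)
  assume "\<not> thesis"
  then have "\<forall>w\<in>A. real_of_int (\<Sum>v\<in>A. f v) / card A < f w" using that by force
  then have "(\<Sum>w\<in>A. real_of_int (\<Sum>v\<in>A. f v) / card A) < (\<Sum>w\<in>A. real_of_int (f w))"
    using assms by (intro sum_strict_mono) auto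
  then show False using assms by simp
qed

lemma deficit_turn:
  assumes "complete_digraph n G" "fst s \<subseteq> verts G" "w \<in> fst (turn G v s)"
  shows "deficit (turn G v s) w = deficit s w - (if w = v then 1 else 0)
    - 2 * (int (card (fst s)) - int (card (fst (turn G v s))))"
  using turn_complete(2)[OF assms] by (simp add: deficit_def snd_place split: if_splits)

lemma turn_quiet:
  assumes K: "complete_digraph n G" and D: "fst s \<subseteq> verts G" and v: "v \<in> fst s"
    and q: "fst (turn G v s) = fst s"
  shows "w \<in> fst s \<Longrightarrow> deficit (turn G v s) w = deficit s w - (if w = v then 1 else 0)"
    and "total_deficit (turn G v s) = total_deficit s - 1"
proof -
  show *: "deficit (turn G v s) w = deficit s w - (if w = v then 1 else 0)" if "w \<in> fst s" for w
    using deficit_turn[OF K D, of w v] q that by simp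
  have "total_deficit (turn G v s) = (\<Sum>w\<in>fst s. deficit s w - (if w = v then 1 else 0))"
    unfolding total_deficit_def q by (intro sum.cong) (auto simp: *)
  then show "total_deficit (turn G v s) = total_deficit s - 1"
    using v finite_dirty_complete[OF K D] by (simp add: total_deficit_def sum_subtractf)
qed

text \<open>
  In a stable position all deficits are positive, so leaving out the vertices that fire does not
  increase the sum.
\<close>

lemma turn_firing:
  assumes K: "complete_digraph n G" and D: "fst s \<subseteq> verts G" and st: "stable_position G s"
    and v: "v \<in> fst s"
  defines "m \<equiv> int (card (fst s))" and "m' \<equiv> int (card (fst (turn G v s)))"
  shows "total_deficit (turn G v s) \<le> total_deficit s - 2 * (m - m') * m'"
    and "total_deficit (turn G v s) \<le> m' * (m' - 1 - (m - m'))"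
    and "0 \<le> total_deficit (turn G v s)"
proof -
  let ?t = "turn G v s"
  have fin: "finite (fst s)" using finite_dirty_complete[OF K D] by simp
  have sub: "fst ?t \<subseteq> fst s" using turn_complete(1)[OF K D] .
  have D': "fst ?t \<subseteq> verts G" using sub D by simp
  have def: "deficit ?t w = deficit s w - (if w = v then 1 else 0) - 2 * (m - m')"
    if "w \<in> fst ?t" for w
    using deficit_turn[OF K D that] by (simp add: m_def m'_def)
  have "total_deficit ?t = (\<Sum>w\<in>fst ?t. deficit s w - (if w = v then 1 else 0) - 2 * (m - m'))"
    unfolding total_deficit_def by (intro sum.cong) (auto simp: def)
  also have "\<dots> \<le> (\<Sum>w\<in>fst ?t. deficit s w - 2 * (m - m'))" by (intro sum_mono) auto
  also have "\<dots> = (\<Sum>w\<in>fst ?t. deficit s w) - 2 * (m - m') * m'"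
    by (simp add: sum_subtractf m'_def)
  also have "(\<Sum>w\<in>fst ?t. deficit s w) \<le> total_deficit s"
    unfolding total_deficit_def using stable_deficit_pos[OF K D st]
    by (intro sum_mono2[OF fin sub]) force
  finally show "total_deficit ?t \<le> total_deficit s - 2 * (m - m') * m'" by simp
  have "deficit ?t w \<le> m' - 1 - (m - m')" if "w \<in> fst ?t" for w
    using turn_complete(2)[OF K D that] by (simp add: deficit_def m_def m'_def)
  then have "total_deficit ?t \<le> (\<Sum>w\<in>fst ?t. m' - 1 - (m - m'))"
    unfolding total_deficit_def by (intro sum_mono) auto
  then show "total_deficit ?t \<le> m' * (m' - 1 - (m - m'))" by (simp add: m'_def)
  show "0 \<le> total_deficit ?t"
    unfolding total_deficit_def
    using stable_deficit_pos[OF K D' turn_reachable(2)[OF K D]] by (intro sum_nonneg) force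
qed

abbreviation turns_bound :: "'a position \<Rightarrow> real \<Rightarrow> real" where
  "turns_bound s d \<equiv>
    phase_bound (card (fst s)) (total_deficit s) d + 10 * card (fst s)"

text \<open>
  Once something has fired, a new phase starts, in which Min picks a vertex of at most average
  deficit. For each fired vertex 10 turns are available; they pay for the error of \<open>val_phase\<close>,
  for the turn itself, and for an error of 2 per vertex when the firings of a cascade are
  merged.
\<close>

lemma game_length_after_firing:
  assumes K: "complete_digraph n G" and D: "fst s \<subseteq> verts G" and st: "stable_position G s"
    and v: "v \<in> fst s" and fired: "fst (turn G v s) \<noteq> fst s" and d: "0 \<le> d"
    and bound: "\<And>w. w \<in> fst (turn G v s) \<Longrightarrow>
      game_length G p (turn G v s) \<le> turns_bound (turn G v s) (deficit (turn G v s) w + 1 / 2)"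
  shows "1 + game_length G p (turn G v s) \<le> turns_bound s d"
proof -
  let ?t = "turn G v s"
  define m where "m = real (card (fst s))"
  define m' where "m' = real (card (fst ?t))"
  define S where "S = real_of_int (total_deficit s)"
  define S' where "S' = real_of_int (total_deficit ?t)"
  have fin: "finite (fst s)" using finite_dirty_complete[OF K D] by simp
  have sub: "fst ?t \<subseteq> fst s" using turn_complete(1)[OF K D] .
  have "card (fst ?t) < card (fst s)" using sub fired fin by (intro psubset_card_mono) auto
  then have g: "m' + 1 \<le> m" by (simp add: m_def m'_def)
  note tf = turn_firing[OF K D st v]
  have S1: "S' \<le> S - 2 * (m - m') * m'"
    using tf(1) unfolding m_def m'_def S_def S'_def by (metis (mono_tags) of_int_diff of_int_le_iff of_int_mult of_int_numeral of_int_of_nat_eq)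
  have S2: "S' \<le> m' * (m' - 1 - (m - m'))"
    using tf(2) unfolding m_def m'_def S_def S'_def by (metis (mono_tags) of_int_diff of_int_le_iff of_int_mult of_int_1 of_int_of_nat_eq)
  have S0: "0 \<le> S'" using tf(3) by (simp add: S'_def)
  have "1 + game_length G p ?t \<le> val (m - 1) (S - 2 * (m - 1)) + 10 * m"
  proof (cases "fst ?t = {}")
    case True
    then show ?thesis using g val_nonneg[of "m - 1" "S - 2 * (m - 1)"]
      by (simp add: game_length_empty m'_def)
  next
    case False
    have fin': "finite (fst ?t)" using sub fin by (rule finite_subset)
    obtain w where w: "w \<in> fst ?t" "real_of_int (deficit ?t w) \<le> S' / m'"
      using exists_le_average[OF fin' False, of "deficit ?t"]
      unfolding S'_def m'_def total_deficit_def .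
    have m': "1 \<le> m'" using False fin' by (simp add: m'_def Suc_le_eq card_gt_0_iff)
    have "S' \<le> m'\<^sup>2"
    proof -
      have "m' * (m' - 1 - (m - m')) \<le> m' * m'" using g m' by (intro mult_left_mono) auto
      then show ?thesis using S2 by (simp add: power2_eq_square)
    qed
    then have phase: "phase_bound m' S' (S' / m') \<le> val m' S' + 8"
      using val_phase[of "card (fst ?t)" S'] S0 m' by (simp add: phase_bound_def m'_def)
    have "game_length G p ?t \<le> phase_bound m' S' (deficit ?t w + 1 / 2) + 10 * m'"
      using bound[OF w(1)] by (simp add: m'_def S'_def)
    also have "\<dots> \<le> phase_bound m' S' (S' / m') + 1 + 10 * m'"
      using phase_bound_half[of m' S' "deficit ?t w"] phase_bound_mono[OF w(2), of m' S'] by simp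
    also have "\<dots> \<le> val m' S' + 9 + 10 * m'" using phase by simp
    finally have 1: "game_length G p ?t \<le> val m' S' + 9 + 10 * m'" .
    have 2: "val m' S' \<le> val m' (S' - 2 * (m - 1 - m')) + 2 * (m - 1 - m')"
      using val_lipschitz[of "S' - 2 * (m - 1 - m')" S' m'] g by simp
    have "val m' (S' - 2 * (m - 1 - m')) \<le> val (m' + (m - 1 - m')) (S - 2 * (m - 1))"
    proof (rule val_cascade)
      show "1 \<le> m'" "0 \<le> m - 1 - m'" using m' g by simp_all
      have "m' * (m' - 1 - (m - m')) \<le> m' * (m' - (m - 1 - m'))"
        using m' by (intro mult_left_mono) auto
      with S2 have "S' \<le> m' * (m' - (m - 1 - m'))" by (rule order_trans)
      then show "S' - 2 * (m - 1 - m') \<le> m' * (m' - (m - 1 - m'))" using g by simp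
      show "S' - 2 * (m - 1 - m') + 2 * (m - 1 - m') * m' \<le> S - 2 * (m - 1)"
        using S1 by (simp add: algebra_simps)
    qed
    then have 3: "val m' (S' - 2 * (m - 1 - m')) \<le> val (m - 1) (S - 2 * (m - 1))" by simp
    show ?thesis using 1 2 3 g by simp
  qed
  moreover have "phase_bound m S 0 \<le> phase_bound m S d" using d by (rule phase_bound_mono)
  ultimately show ?thesis by (simp add: m_def S_def phase_bound_def)
qed

text \<open>
  The vertex \<open>w\<close> is arbitrary, and Min's strategy is to brush it. As long as nothing fires, both
  sides decrease by one per turn; a brush that Max puts on \<open>w\<close> only helps Min.
\<close>

lemma game_length_le_turns_bound:
  assumes K: "complete_digraph n G" and "fst s \<subseteq> verts G" and "stable_position G s"
    and "w \<in> fst s"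
  shows "game_length G Player_Min s \<le> turns_bound s (deficit s w)"
    and "game_length G Player_Max s \<le> turns_bound s (deficit s w + 1 / 2)"
proof -
  have "finite (fst s)" using finite_dirty_complete[OF assms(1,2)] by simp
  then have "fst s \<subseteq> verts G \<and> stable_position G s \<longrightarrow> (\<forall>w\<in>fst s.
      game_length G Player_Min s \<le> turns_bound s (deficit s w) \<and>
      game_length G Player_Max s \<le> turns_bound s (deficit s w + 1 / 2))"
  proof (induction s rule: play_induct[where G = G])
    case (play s)
    show ?case
    proof (intro impI ballI)
      fix w assume D: "fst s \<subseteq> verts G \<and> stable_position G s" and w: "w \<in> fst s"
      then have D: "fst s \<subseteq> verts G" and st: "stable_position G s" by auto
      have IH: "game_length G Player_Min (turn G v s) \<le> turns_bound (turn G v s) (deficit (turn G v s) u)"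
        "game_length G Player_Max (turn G v s) \<le> turns_bound (turn G v s) (deficit (turn G v s) u + 1 / 2)"
        if "v \<in> fst s" "u \<in> fst (turn G v s)" for u v
        using play.IH[OF that(1)] that(2) turn_complete(1)[OF K D, of v] D
          turn_reachable(2)[OF K D, of v] by auto
      have dw: "0 \<le> deficit s w" using stable_deficit_pos[OF K D st w] by simp
      have Min: "1 + game_length G Player_Max (turn G w s) \<le> turns_bound s (deficit s w)"
      proof (cases "fst (turn G w s) = fst s")
        case True
        show ?thesis
          using IH(2)[OF w, of w] turn_quiet[OF K D w True] w True
          by (simp add: phase_bound_def algebra_simps)
      next
        case False
        show ?thesis
          by (rule game_length_after_firing[OF K D st w False]) (use dw IH(2)[OF w] in auto)
      qed
      have Max: "1 + game_length G Player_Min (turn G v s) \<le> turns_bound s (deficit s w + 1 / 2)"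
        if v: "v \<in> fst s" for v
      proof (cases "fst (turn G v s) = fst s")
        case True
        have "game_length G Player_Min (turn G v s)
            \<le> turns_bound (turn G v s) (deficit (turn G v s) w)"
          using IH(1)[OF v] True w by simp
        also have "\<dots> \<le> turns_bound (turn G v s) (deficit s w)"
          using turn_quiet(1)[OF K D v True w] by (auto intro!: phase_bound_mono)
        also have "1 + \<dots> = turns_bound s (deficit s w + 1 / 2)"
          unfolding True turn_quiet(2)[OF K D v True] by (simp add: phase_bound_def algebra_simps)
        finally show ?thesis by simp
      next
        case False
        show ?thesis
        proof (rule game_length_after_firing[OF K D st v False])
          fix u assume u: "u \<in> fst (turn G v s)"
          show "game_length G Player_Min (turn G v s)
              \<le> turns_bound (turn G v s) (deficit (turn G v s) u + 1 / 2)"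
            using IH(1)[OF v u] phase_bound_mono[of "deficit (turn G v s) u" "deficit (turn G v s) u + 1 / 2"
              "card (fst (turn G v s))" "total_deficit (turn G v s)"] by simp
        qed (use dw in simp)
      qed
      show "game_length G Player_Min s \<le> turns_bound s (deficit s w) \<and>
          game_length G Player_Max s \<le> turns_bound s (deficit s w + 1 / 2)"
      proof
        show "game_length G Player_Min s \<le> turns_bound s (deficit s w)"
          using game_length_Min_le[OF play.hyps w, of G] Min by linarith
        obtain v where "v \<in> fst s"
          "game_length G Player_Max s = 1 + game_length G Player_Min (turn G v s)"
          using game_length_Max_attained[OF play.hyps] w by blast
        then show "game_length G Player_Max s \<le> turns_bound s (deficit s w + 1 / 2)"
          using Max[of v] by simp
      qed
    qed
  qed
  then show "game_length G Player_Min s \<le> turns_bound s (deficit s w)"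
    and "game_length G Player_Max s \<le> turns_bound s (deficit s w + 1 / 2)"
    using assms by auto
qed

theorem game_brush_number_complete_le:
  assumes K: "complete_digraph n G" and n: "n \<ge> 2"
  shows "b\<^sub>g G \<le> (real n)\<^sup>2 / exp 1 + 10 * n + 8"
proof -
  let ?s = "(verts G, \<lambda>_. 0 :: nat)"
  have card: "card (verts G) = n" using K by (simp add: complete_digraph_def)
  have def: "deficit ?s v = int n - 1" for v by (simp add: deficit_def card)
  have st: "stable_position G ?s"
    unfolding stable_position_def using fires_complete_iff[OF K, of ?s] n by (auto simp: def)
  obtain w where w: "w \<in> verts G" using card n by fastforce
  have td: "total_deficit ?s = int n * (int n - 1)" by (simp add: total_deficit_def def card)
  have "b\<^sub>g G \<le> turns_bound ?s (deficit ?s w)"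
    unfolding game_brush_number_def by (rule game_length_le_turns_bound(1)[OF K _ st]) (use w in auto)
  also have "\<dots> = phase_bound n (real n * (real n - 1)) (real n * (real n - 1) / real n) + 10 * n"
    using n by (simp add: td def card)
  also have "\<dots> \<le> val n (real n * (real n - 1)) + 8 + 10 * n"
    using val_phase[of n "real n * (real n - 1)"] n
    by (simp add: phase_bound_def power2_eq_square)
  also have "val n (real n * (real n - 1)) \<le> val n ((real n)\<^sup>2)"
    by (intro val_mono) (simp add: power2_eq_square algebra_simps)
  also have "val n ((real n)\<^sup>2) = (real n)\<^sup>2 / exp 1"
    using n by (simp add: val_def phi_def exp_minus inverse_eq_divide)
  finally show ?thesis by simp
qed

section \<open>Counting vertices of small deficit\<close>

text \<open>
  Draw every dirty vertex as a column whose height above the water is its deficit, and number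
  the rows of cells from the water upwards. Then \<open>low s y\<close> counts the columns whose cell in row
  \<open>y\<close> is gone.
\<close>

definition low :: "'a position \<Rightarrow> int \<Rightarrow> int" where
  "low s y = int (card {v \<in> fst s. deficit s v < y})"

definition cleaned :: "nat \<Rightarrow> 'a position \<Rightarrow> int" where
  "cleaned n s = int n - int (card (fst s))"

lemma cleaned_place [simp]: "cleaned n (place v s) = cleaned n s"
  by (simp add: cleaned_def)

lemma low_nonneg: "0 \<le> low s y"
  by (simp add: low_def)

lemma low_le: "finite (fst s) \<Longrightarrow> low s y \<le> int (card (fst s))"
  unfolding low_def by (simp add: card_mono)

lemma low_mono: "finite (fst s) \<Longrightarrow> y \<le> z \<Longrightarrow> low s y \<le> low s z"
  unfolding low_def of_nat_le_iff by (rule card_mono) auto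

lemma low_place:
  assumes "finite (fst s)" "v \<in> fst s"
  shows "low (place v s) y = low s y + (if deficit s v = y then 1 else 0)"
proof (cases "deficit s v = y")
  case True
  then have "{w \<in> fst s. deficit (place v s) w < y} = insert v {w \<in> fst s. deficit s w < y}"
    using assms(2) by (auto simp: deficit_place split: if_splits)
  then show ?thesis using True assms(1) by (simp add: low_def)
next
  case False
  then have "{w \<in> fst s. deficit (place v s) w < y} = {w \<in> fst s. deficit s w < y}"
    by (auto simp: deficit_place split: if_splits)
  then show ?thesis using False by (simp add: low_def)
qed

text \<open>
  A firing removes a column that is under water and raises the water by two rows.
\<close>

lemma low_fires:
  assumes K: "complete_digraph n G" and D: "fst s \<subseteq> verts G" and f: "fires G s t" and y: "-1 \<le> y"
  shows "low t y = low s (y + 2) - 1"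
proof -
  obtain v where v: "v \<in> fst s" "deficit s v \<le> 0" "fst t = fst s - {v}"
    using fires_vertex[OF K D f] by blast
  have fin: "finite {w \<in> fst s. deficit s w < y + 2}" using finite_dirty_complete[OF K D] by simp
  have vin: "v \<in> {w \<in> fst s. deficit s w < y + 2}" using v y by simp
  have eq: "{w \<in> fst t. deficit t w < y} = {w \<in> fst s. deficit s w < y + 2} - {v}"
  proof (rule set_eqI)
    fix w
    have "w \<in> fst t \<longleftrightarrow> w \<in> fst s \<and> w \<noteq> v" unfolding v(3) by simp
    then show "w \<in> {w \<in> fst t. deficit t w < y} \<longleftrightarrow> w \<in> {w \<in> fst s. deficit s w < y + 2} - {v}"
      using fires_deficit[OF K D f, of w] by (cases "w \<in> fst t") (simp_all add: diff_less_eq)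
  qed
  have "card {w \<in> fst s. deficit s w < y + 2} = Suc (card {w \<in> fst t. deficit t w < y})"
    unfolding eq by (rule card.remove[OF fin vin])
  then show ?thesis by (simp add: low_def)
qed

lemma low_fires_pos:
  assumes "complete_digraph n G" "fst s \<subseteq> verts G" "fires G s t" "1 \<le> y"
  shows "1 \<le> low s y"
  using low_fires[OF assms(1-3), of "y - 2"] low_nonneg[of t "y - 2"] assms(4) by simp

lemma cleaned_fires:
  assumes "complete_digraph n G" "fst s \<subseteq> verts G" "fires G s t"
  shows "cleaned n t = cleaned n s + 1"
  using fires_card[OF assms] by (simp add: cleaned_def)

lemma sum_shift_two:
  fixes f :: "int \<Rightarrow> int"
  shows "(\<Sum>y\<in>{1..l - 2}. f (y + 2)) = (\<Sum>y\<in>{3..l}. f y)"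
  by (rule sum.reindex_bij_witness[of _ "\<lambda>y. y - 2" "\<lambda>y. y + 2"]) auto

lemma split_first_two: "2 \<le> (l::int) \<Longrightarrow> {1..l} = insert 1 (insert 2 {3..l})"
  by auto

section \<open>The loss behind a row\<close>

text \<open>
  The cells in rows 1 to \<open>l\<close> that are gone, except that row \<open>y\<close> counts for at most \<open>y div 2\<close>,
  the number of firings that raise the water to the foot of row \<open>y\<close>. With this cap a firing
  lowers \<open>captured\<close> by a fixed amount, even if the column was far below the water, so that
  cascades need no separate treatment.
\<close>

definition captured :: "'a position \<Rightarrow> int \<Rightarrow> int" where
  "captured s l = (\<Sum>y\<in>{1..l}. min (low s y) (y div 2))"

text \<open>
  Row \<open>r\<close> is counted from the bottom, with the water at level \<open>2 k\<close>. The loss adds up the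
  captured cells up to row \<open>r\<close>, the same quantity for the \<open>k\<close> clean vertices, which is the sum
  of \<open>r - 2 i - 1\<close> over \<open>i < k\<close>, and the number of columns that still reach into row \<open>r + 1\<close>.
  These last ones are the turns that Max may still need for row \<open>r + 1\<close>, so the loss anticipates
  what Min can capture meanwhile.
\<close>

definition loss :: "nat \<Rightarrow> int \<Rightarrow> 'a position \<Rightarrow> int" where
  "loss n r s = (let k = cleaned n s; l = r - 2 * k in
    captured s l + (int (card (fst s)) - low s (l + 1)) + k * (r - k))"

lemma captured_nonneg: "0 \<le> captured s l"
  unfolding captured_def by (intro sum_nonneg) (auto simp: low_nonneg)

lemma captured_place:
  assumes "finite (fst s)" "v \<in> fst s"
  shows "captured (place v s) l \<le> captured s l + (if deficit s v \<le> l then 1 else 0)"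
proof -
  have "captured (place v s) l \<le> (\<Sum>y\<in>{1..l}. min (low s y) (y div 2) + (if deficit s v = y then 1 else 0))"
    unfolding captured_def by (intro sum_mono) (auto simp: low_place[OF assms])
  also have "\<dots> \<le> captured s l + (if deficit s v \<le> l then 1 else 0)"
    by (auto simp: sum.distrib captured_def)
  finally show ?thesis .
qed

lemma captured_fires:
  assumes K: "complete_digraph n G" and D: "fst s \<subseteq> verts G" and f: "fires G s t" and l: "2 \<le> l"
  shows "captured t (l - 2) = captured s l - (l - 1)"
proof -
  have "captured t (l - 2) = (\<Sum>y\<in>{1..l - 2}. min (low s (y + 2)) ((y + 2) div 2) - 1)"
    unfolding captured_def by (intro sum.cong) (auto simp: low_fires[OF K D f] min_def)
  also have "\<dots> = (\<Sum>y\<in>{3..l}. min (low s y) (y div 2) - 1)" by (rule sum_shift_two)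
  also have "\<dots> = (\<Sum>y\<in>{3..l}. min (low s y) (y div 2)) - (l - 2)"
    using l by (simp add: sum_subtractf)
  finally have 1: "captured t (l - 2) = \<dots>" .
  have "captured s l = 1 + (\<Sum>y\<in>{3..l}. min (low s y) (y div 2))"
    unfolding captured_def split_first_two[OF l]
    using low_fires_pos[OF K D f, of 1] low_fires_pos[OF K D f, of 2] by simp
  with 1 show ?thesis by simp
qed

text \<open>
  The amount that leaves \<open>captured\<close> is the one that the new clean vertex contributes.
\<close>

lemma loss_fires:
  assumes K: "complete_digraph n G" and D: "fst s \<subseteq> verts G" and f: "fires G s t"
    and l: "2 \<le> r - 2 * cleaned n s"
  shows "loss n r t = loss n r s"
proof -
  define k where "k = cleaned n s"
  have k': "cleaned n t = k + 1" by (simp add: k_def cleaned_fires[OF K D f])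
  have m: "int (card (fst t)) = int (card (fst s)) - 1"
    using cleaned_fires[OF K D f] by (simp add: cleaned_def)
  have l': "r - 2 * (k + 1) = r - 2 * k - 2" by simp
  have "captured t (r - 2 * k - 2) = captured s (r - 2 * k) - (r - 2 * k - 1)"
    using captured_fires[OF K D f l] by (simp add: k_def)
  moreover have "low t (r - 2 * k - 2 + 1) = low s (r - 2 * k + 1) - 1"
    using low_fires[OF K D f, of "r - 2 * k - 2 + 1"] l by (simp add: k_def algebra_simps)
  ultimately show ?thesis
    unfolding loss_def Let_def k' k_def[symmetric] l' m by (simp add: algebra_simps)
qed

text \<open>
  A round of both players does not increase the loss as long as some column reaches into row
  \<open>r + 1\<close>, since Max can answer on such a column.
\<close>

lemma loss_place:
  assumes "finite (fst s)" "v \<in> fst s"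
  shows "loss n r (place v s) \<le> loss n r s + 1"
    and "deficit s v = r - 2 * cleaned n s + 1 \<Longrightarrow> loss n r (place v s) \<le> loss n r s - 1"
  using captured_place[OF assms, of "r - 2 * cleaned n s"] low_place[OF assms]
  by (auto simp: loss_def Let_def split: if_splits)

lemma sum_min_half:
  fixes l :: nat
  assumes "0 \<le> c" "2 * c \<le> int l"
  shows "(\<Sum>y\<in>{1..int l}. min c (y div 2)) \<le> c * (int l - c)"
  using assms
proof (induction l arbitrary: c)
  case (Suc l)
  have ins: "{1..int (Suc l)} = insert (int l + 1) {1..int l}" by auto
  show ?case
  proof (cases "2 * c \<le> int l")
    case True
    then have "(\<Sum>y\<in>{1..int l}. min c (y div 2)) \<le> c * (int l - c)" using Suc by blast
    then show ?thesis unfolding ins by (simp add: algebra_simps min_le_iff_disj)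
  next
    case False
    then have c: "int l + 1 = 2 * c" using Suc.prems by simp
    have "(\<Sum>y\<in>{1..int l}. min c (y div 2)) = (\<Sum>y\<in>{1..int l}. min (c - 1) (y div 2))"
      using c by (intro sum.cong) auto
    also have "\<dots> \<le> (c - 1) * (int l - (c - 1))" using c by (intro Suc.IH) auto
    also have "\<dots> = (c - 1) * c" using c by simp
    finally show ?thesis unfolding ins using c by (simp add: algebra_simps)
  qed
qed simp

text \<open>
  If only \<open>c\<close> columns are lower than row \<open>l\<close>, then each row captures at most \<open>c\<close> cells, and by
  the cap the lowest \<open>2 c\<close> rows capture at most \<open>c\<^sup>2\<close> of them together.
\<close>

lemma captured_le:
  assumes "finite (fst s)" "0 \<le> l"
  defines "c \<equiv> min (low s l) (l div 2)"
  shows "captured s l \<le> c * (l - c)"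
proof -
  have "captured s l \<le> (\<Sum>y\<in>{1..l}. min c (y div 2))"
    unfolding captured_def
  proof (rule sum_mono)
    fix y assume y: "y \<in> {1..l}"
    then have "low s y \<le> low s l" "y div 2 \<le> l div 2"
      using low_mono[OF assms(1)] by (auto intro: zdiv_mono1)
    then show "min (low s y) (y div 2) \<le> min c (y div 2)" by (auto simp: c_def)
  qed
  also have "\<dots> \<le> c * (l - c)"
    using sum_min_half[of c "nat l"] assms(2) low_nonneg[of s l] by (auto simp: c_def)
  finally show ?thesis .
qed

lemma loss_ge:
  assumes "finite (fst s)"
  shows "cleaned n s * (r - cleaned n s) \<le> loss n r s"
  using captured_nonneg[of s "r - 2 * cleaned n s"] low_le[OF assms, of "r - 2 * cleaned n s + 1"]
  by (simp add: loss_def Let_def)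

text \<open>
  The invariant of Max's strategy: no column exceeds row \<open>r + 1\<close>, the water is well below, and
  the loss is at most \<open>x\<close>.
\<close>

definition paced :: "nat \<Rightarrow> int \<Rightarrow> real \<Rightarrow> 'a position \<Rightarrow> bool" where
  "paced n r x s \<longleftrightarrow> (\<forall>v\<in>fst s. deficit s v \<le> r - 2 * cleaned n s + 1) \<and>
    4 \<le> r - 2 * cleaned n s \<and> real_of_int (loss n r s) \<le> x"

text \<open>
  Loss \<open>a (r - a)\<close> is what \<open>a\<close> clean vertices account for. As \<open>k (r - k)\<close> grows by more than one
  per vertex while \<open>k < r / 2 - 1\<close>, fewer than \<open>a + 1\<close> vertices can be clean, and the water
  stays low.
\<close>

lemma few_cleaned:
  fixes a :: real
  assumes "finite (fst s)" "2 \<le> r - 2 * cleaned n s" "loss n r s \<le> a * (r - a) + 1"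
    and a: "2 * a \<le> r - 6"
  shows "5 \<le> r - 2 * cleaned n s"
proof (rule ccontr)
  define k where "k = real_of_int (cleaned n s)"
  assume "\<not> 5 \<le> r - 2 * cleaned n s"
  then have "r - 2 * cleaned n s \<le> 4" by simp
  then have "real_of_int (r - 2 * cleaned n s) \<le> 4" by linarith
  then have 1: "r - 2 * k \<le> 4" by (simp add: k_def)
  have 2: "2 \<le> r - 2 * k" using assms(2) unfolding k_def by linarith
  have "real_of_int (cleaned n s * (r - cleaned n s)) \<le> a * (r - a) + 1"
    using loss_ge[OF assms(1), where n = n and r = r] assms(3) by linarith
  then have 3: "k * (r - k) \<le> a * (r - a) + 1" by (simp add: k_def)
  \<comment> \<open>With the water this close to the row, \<open>k\<close> exceeds \<open>a\<close> by at least 1.\<close>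
  have "1 * 4 \<le> (k - a) * (r - k - a)" using 1 2 a by (intro mult_mono) auto
  also have "\<dots> = k * (r - k) - a * (r - a)" by (simp add: algebra_simps)
  finally show False using 3 by simp
qed

lemma paced_fires:
  fixes a :: real
  assumes K: "complete_digraph n G" and D: "fst s \<subseteq> verts G" and f: "fires G s t"
    and p: "paced n r x s" and x: "x \<le> a * (r - a) + 1" and a: "2 * a \<le> r - 6"
  shows "paced n r x t"
proof -
  have k: "cleaned n t = cleaned n s + 1" by (rule cleaned_fires[OF K D f])
  have l: "2 \<le> r - 2 * cleaned n s" "2 \<le> r - 2 * cleaned n t" using p k by (auto simp: paced_def)
  have loss: "loss n r t = loss n r s" by (rule loss_fires[OF K D f l(1)])
  have sub: "fst t \<subseteq> fst s" using fires_psubset[OF f] by auto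
  have fin: "finite (fst t)" using finite_dirty_complete(1)[OF K D] sub by (rule finite_subset[rotated])
  have "\<forall>v\<in>fst t. deficit t v \<le> r - 2 * cleaned n t + 1"
    using p sub k fires_deficit[OF K D f] by (force simp: paced_def)
  moreover have "5 \<le> r - 2 * cleaned n t"
    using few_cleaned[OF fin l(2) _ a] loss p x by (simp add: paced_def)
  ultimately show ?thesis using p loss by (simp add: paced_def)
qed

lemma paced_turn:
  fixes a :: real
  assumes K: "complete_digraph n G" and D: "fst s \<subseteq> verts G"
    and p: "paced n r x (place v s)" and x: "x \<le> a * (r - a) + 1" and a: "2 * a \<le> r - 6"
  shows "paced n r x (turn G v s)"
  by (intro conjunct2[OF turn_invariant[OF K D, where P = "paced n r x"]] p)
    (rule paced_fires[OF K _ _ _ x a])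

lemma paced_place:
  assumes "finite (fst s)" "v \<in> fst s" "paced n r x s"
  shows "paced n r (x + 1) (place v s)"
    and "deficit s v = r - 2 * cleaned n s + 1 \<Longrightarrow> paced n r (x - 1) (place v s)"
proof -
  have "\<forall>w\<in>fst s. deficit (place v s) w \<le> r - 2 * cleaned n s + 1"
    using assms(3) by (auto simp: paced_def deficit_place)
  then show "paced n r (x + 1) (place v s)"
    and "deficit s v = r - 2 * cleaned n s + 1 \<Longrightarrow> paced n r (x - 1) (place v s)"
    using loss_place[OF assms(1,2), where n = n and r = r] assms(3) by (auto simp: paced_def)
qed

text \<open>
  Let \<open>c\<close> columns be lower than row \<open>r\<close>, counted up to \<open>r div 2\<close> and including the clean
  vertices. Passing to the next row removes their cells in row \<open>r\<close> from the loss, and at most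
  \<open>n - c\<close> columns have to be levelled there, so the loss grows by at most \<open>n - 2 c\<close>. If \<open>c \<ge> a\<close>
  this is at most \<open>n - 2 a\<close>. If \<open>c < a\<close>, then the loss was at most \<open>c (r - c)\<close>, which falls
  short of \<open>a (r - a)\<close> by at least the excess \<open>2 (a - c)\<close>.
\<close>

lemma paced_next_row:
  fixes a b :: real
  assumes fin: "finite (fst s)" and p: "paced n r (a * (r - a) + 1) s"
    and full: "low s (r - 2 * cleaned n s + 1) = card (fst s)"
    and a: "2 * a \<le> r - 6" and step: "a * (r - a) + n - 2 * a \<le> b * (r - 1 - b)"
  shows "paced n (r - 1) (b * (r - 1 - b) + 1) s"
proof -
  define k where "k = cleaned n s"
  define l where "l = r - 2 * k"
  define c where "c = min (low s l) (l div 2)"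
  have l: "5 \<le> l" using few_cleaned[OF fin _ _ a] p by (simp add: paced_def l_def k_def)
  have "{v \<in> fst s. deficit s v < l + 1} = fst s"
    using full fin by (intro card_subset_eq) (auto simp: low_def l_def k_def)
  then have below: "\<forall>v\<in>fst s. deficit s v \<le> l" by auto
  have L: "loss n r s = captured s l + k * (r - k)"
    using full by (simp add: loss_def Let_def l_def k_def)
  have "captured s l \<le> c * (l - c)" unfolding c_def using l by (intro captured_le[OF fin]) simp
  then have L2: "loss n r s \<le> (k + c) * (r - (k + c))" by (simp add: L l_def algebra_simps)
  have ins: "{1..l} = insert l {1..l - 1}" using l by auto
  have "captured s l = captured s (l - 1) + c"
    unfolding captured_def c_def ins by simp
  moreover have "r - 1 - 2 * k = l - 1" by (simp add: l_def)
  ultimately have "loss n (r - 1) s = loss n r s + int n - (k + low s l) - (k + c)"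
    unfolding L unfolding loss_def Let_def k_def[symmetric]
    by (simp add: algebra_simps) (simp add: k_def cleaned_def)
  then have "loss n (r - 1) s \<le> loss n r s + int n - 2 * (k + c)" by (simp add: c_def)
  then have L': "real_of_int (loss n (r - 1) s) \<le> loss n r s + n - 2 * real_of_int (k + c)" by linarith
  have "real_of_int (loss n (r - 1) s) \<le> b * (r - 1 - b) + 1"
  proof (cases "a \<le> k + c")
    case True
    then show ?thesis using L' step p by (simp add: paced_def)
  next
    case False
    define e where "e = real_of_int (k + c)"
    have "real_of_int (loss n r s) \<le> real_of_int ((k + c) * (r - (k + c)))" using L2 by linarith
    then have "loss n r s \<le> e * (r - e)" by (simp add: e_def)
    moreover have "0 \<le> (a - e) * (r - a - e - 2)" using False a by (intro mult_nonneg_nonneg) (auto simp: e_def)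
    ultimately have "loss n r s + n - 2 * e \<le> a * (r - a) + n - 2 * a" by (simp add: algebra_simps)
    then show ?thesis using L' step by (simp add: e_def)
  qed
  then show ?thesis using l below by (simp add: paced_def l_def k_def)
qed

section \<open>Counting the turns at the end\<close>

text \<open>
  A lower bound for the number of turns played so far that can be read off the dirty vertices
  alone. When the \<open>i\<close>-th vertex fires, counting from 0, it has at least \<open>n - 1 - i\<close> brushes, of
  which \<open>i\<close> came from earlier firings; the sum of \<open>n - 1 - 2 i\<close> over the \<open>k\<close> clean vertices is
  \<open>k (n - k)\<close>. A dirty vertex has received \<open>b - k\<close> brushes from the players.
\<close>

definition paid :: "nat \<Rightarrow> 'a position \<Rightarrow> int" where
  "paid n s = cleaned n s * int (card (fst s)) + (\<Sum>v\<in>fst s. int (snd s v) - cleaned n s)"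

lemma paid_fires:
  assumes K: "complete_digraph n G" and D: "fst s \<subseteq> verts G" and f: "fires G s t"
  shows "paid n t \<le> paid n s"
proof -
  obtain v where v: "v \<in> fst s" "deficit s v \<le> 0" "fst t = fst s - {v}"
    using fires_vertex[OF K D f] by blast
  note c = fires_card[OF K D f]
  have fin: "finite (fst s)" using finite_dirty_complete[OF K D] by simp
  have k: "cleaned n t = cleaned n s + 1" by (rule cleaned_fires[OF K D f])
  have "(\<Sum>w\<in>fst t. int (snd t w) - cleaned n t) = (\<Sum>w\<in>fst t. int (snd s w) - cleaned n s)"
    by (intro sum.cong) (auto simp: fires_brushes[OF K D f] k)
  moreover have "(\<Sum>w\<in>fst s. int (snd s w) - cleaned n s)
      = int (snd s v) - cleaned n s + (\<Sum>w\<in>fst t. int (snd s w) - cleaned n s)"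
    unfolding v(3) by (rule sum.remove[OF fin v(1)])
  moreover have "int (card (fst t)) \<le> int (snd s v)" using v(2) c by (simp add: deficit_def)
  ultimately show ?thesis using c by (simp add: paid_def k algebra_simps)
qed

lemma paid_turn:
  assumes K: "complete_digraph n G" and D: "fst s \<subseteq> verts G" and v: "v \<in> fst s"
  shows "paid n (turn G v s) \<le> paid n s + 1"
proof -
  have fin: "finite (fst s)" using finite_dirty_complete[OF K D] by simp
  have "paid n (place v s) = paid n s + 1"
  proof -
    have "(\<Sum>w\<in>fst s. int (snd (place v s) w) - cleaned n s)
        = (\<Sum>w\<in>fst s. (int (snd s w) - cleaned n s) + (if w = v then 1 else 0))"
      by (intro sum.cong) (auto simp: snd_place)
    then show ?thesis using v fin by (simp add: paid_def sum.distrib)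
  qed
  then show ?thesis
    by (intro conjunct2[OF turn_invariant[OF K D, where P = "\<lambda>t. paid n t \<le> paid n s + 1"]])
      (simp, rule order_trans[OF paid_fires[OF K]])
qed

text \<open>
  A lower bound for the remaining turns, whoever plays them: the columns that drown before the
  water covers row \<open>y\<close>, \<open>(y + 1) div 2\<close> in number, must have lost their cell in this row.
\<close>

definition needed :: "nat \<Rightarrow> int \<Rightarrow> 'a position \<Rightarrow> int" where
  "needed n r s = (\<Sum>y\<in>{1..r - 2 * cleaned n s}. max 0 ((y + 1) div 2 - low s y))"

text \<open>
  Firings are free: the drowned column and the shift by two rows cancel.
\<close>

lemma needed_fires:
  assumes K: "complete_digraph n G" and D: "fst s \<subseteq> verts G" and f: "fires G s t"
  shows "needed n r s \<le> needed n r t"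
proof -
  define l where "l = r - 2 * cleaned n s"
  let ?f = "\<lambda>y. max 0 ((y + 1) div 2 - low s y)"
  have "needed n r t = (\<Sum>y\<in>{1..l - 2}. ?f (y + 2))"
    unfolding needed_def cleaned_fires[OF K D f] l_def
    by (intro sum.cong) (auto simp: low_fires[OF K D f])
  then have t: "needed n r t = sum ?f {3..l}" using sum_shift_two[of ?f l] by simp
  have pos: "1 \<le> low s 1" "1 \<le> low s 2" using low_fires_pos[OF K D f] by auto
  have "sum ?f {1..l} \<le> sum ?f ({1, 2} \<union> {3..l})"
    by (intro sum_mono2) auto
  also have "\<dots> = sum ?f {3..l}" using pos by simp
  finally show ?thesis by (simp add: t) (simp add: needed_def l_def)
qed

lemma needed_turn:
  assumes K: "complete_digraph n G" and D: "fst s \<subseteq> verts G" and v: "v \<in> fst s"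
  shows "needed n r s - 1 \<le> needed n r (turn G v s)"
proof -
  have fin: "finite (fst s)" using finite_dirty_complete[OF K D] by simp
  have "needed n r s \<le> (\<Sum>y\<in>{1..r - 2 * cleaned n s}.
      max 0 ((y + 1) div 2 - low (place v s) y) + (if deficit s v = y then 1 else 0))"
    unfolding needed_def by (intro sum_mono) (auto simp: low_place[OF fin v])
  also have "\<dots> \<le> needed n r (place v s) + 1"
    by (auto simp: needed_def sum.distrib)
  finally show ?thesis
    by (intro conjunct2[OF turn_invariant[OF K D, where P = "\<lambda>t. needed n r s - 1 \<le> needed n r t"]])
      (simp, rule order_trans[OF _ needed_fires[OF K]])
qed

lemma game_length_ge_needed:
  assumes K: "complete_digraph n G" and "fst s \<subseteq> verts G" and r: "r \<le> 2 * int n"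
  shows "needed n r s \<le> int (game_length G p s)"
proof -
  have "finite (fst s)" using finite_dirty_complete[OF assms(1,2)] by simp
  then have "fst s \<subseteq> verts G \<longrightarrow> (\<forall>p. needed n r s \<le> int (game_length G p s))"
  proof (induction s rule: play_induct[where G = G])
    case (play s)
    show ?case
    proof (intro impI allI)
      fix p assume D: "fst s \<subseteq> verts G"
      show "needed n r s \<le> int (game_length G p s)"
      proof (cases "fst s = {}")
        case True
        then show ?thesis using r by (simp add: needed_def cleaned_def)
      next
        case False
        have "needed n r s \<le> 1 + int (game_length G q (turn G v s))" if "v \<in> fst s" for q v
        proof -
          have "fst (turn G v s) \<subseteq> verts G" using turn_complete(1)[OF K D, of v] D by simp
          then have "needed n r (turn G v s) \<le> int (game_length G q (turn G v s))"
            using play.IH[OF that] by simp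
          then show ?thesis using needed_turn[OF K D that, of r] by linarith
        qed
        then show ?thesis
          using game_length_Min_attained[OF play.hyps False, of G]
            game_length_Max_attained[OF play.hyps False, of G]
          by (cases p) (metis of_nat_1 of_nat_add)+
      qed
    qed
  qed
  then show ?thesis using assms(2) by blast
qed

lemma sum_half_up:
  fixes l :: nat
  shows "int l * int l \<le> 4 * (\<Sum>y\<in>{1..int l}. (y + 1) div 2)"
proof (induction l)
  case (Suc l)
  have ins: "{1..int (Suc l)} = insert (int l + 1) {1..int l}" by auto
  show ?case unfolding ins using Suc by (simp add: algebra_simps)
qed simp

text \<open>
  When all columns are at most \<open>r\<close> high, every row above \<open>r\<close> has been paid in full, and each row
  \<open>y \<le> r\<close> costs at least \<open>(y + 1) div 2\<close> cells, paid or needed. The sum is \<open>n (n - r) + r\<^sup>2 / 4\<close>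
  up to \<open>n\<close>.
\<close>

lemma paid_needed:
  assumes K: "complete_digraph n G" and D: "fst s \<subseteq> verts G"
    and l: "0 \<le> r - 2 * cleaned n s"
    and full: "low s (r - 2 * cleaned n s + 1) = card (fst s)"
  shows "4 * (int n * (int n - r) - int n) + r * r \<le> 4 * (paid n s + needed n r s)"
proof -
  define k where "k = cleaned n s"
  define l where "l = r - 2 * k"
  define m where "m = int (card (fst s))"
  have fin: "finite (fst s)" using finite_dirty_complete[OF K D] by simp
  have l0: "0 \<le> l" using assms(3) by (simp add: l_def k_def)
  have k0: "0 \<le> k" using finite_dirty_complete(2)[OF K D] by (simp add: k_def cleaned_def)
  have km: "k + m = int n" by (simp add: k_def m_def cleaned_def)
  have "{v \<in> fst s. deficit s v < l + 1} = fst s"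
    using full fin by (intro card_subset_eq) (auto simp: low_def l_def k_def)
  then have below: "deficit s v \<le> l" if "v \<in> fst s" for v using that by auto
  have count: "(\<Sum>y\<in>{1..l}. if deficit s v < y then 1 else 0) \<le> l - deficit s v"
    if "v \<in> fst s" for v
  proof -
    have "(\<Sum>y\<in>{1..l}. if deficit s v < y then 1 else 0 :: int) = int (card ({1..l} \<inter> {y. deficit s v < y}))"
      by (simp add: sum.If_cases)
    also have "\<dots> \<le> int (card {deficit s v <.. l})" unfolding of_nat_le_iff by (rule card_mono) auto
    also have "\<dots> = l - deficit s v" using below[OF that] by simp
    finally show ?thesis .
  qed
  have "(\<Sum>y\<in>{1..l}. low s y) = (\<Sum>y\<in>{1..l}. \<Sum>v\<in>fst s. if deficit s v < y then 1 else 0)"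
    using fin by (intro sum.cong refl) (simp add: low_def sum.If_cases Int_def)
  also have "\<dots> = (\<Sum>v\<in>fst s. \<Sum>y\<in>{1..l}. if deficit s v < y then 1 else 0)"
    by (rule sum.swap)
  also have "\<dots> \<le> (\<Sum>v\<in>fst s. l - deficit s v)" by (intro sum_mono count)
  also have "\<dots> = (\<Sum>v\<in>fst s. (int (snd s v) - k) + (l + k + 1 - m))"
    by (intro sum.cong) (auto simp: deficit_def m_def)
  also have "\<dots> = (\<Sum>v\<in>fst s. int (snd s v) - k) + m * (l + k + 1 - m)"
    unfolding sum.distrib by (simp add: m_def)
  finally have 1: "(\<Sum>y\<in>{1..l}. low s y) \<le> paid n s - k * m + m * (l + k + 1 - m)"
    by (simp add: paid_def k_def m_def)
  have "(\<Sum>y\<in>{1..l}. (y + 1) div 2 - low s y) \<le> needed n r s"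
    unfolding needed_def k_def[symmetric] l_def[symmetric] by (intro sum_mono) simp
  then have 2: "(\<Sum>y\<in>{1..l}. (y + 1) div 2) - (\<Sum>y\<in>{1..l}. low s y) \<le> needed n r s"
    by (simp add: sum_subtractf)
  have 3: "l * l \<le> 4 * (\<Sum>y\<in>{1..l}. (y + 1) div 2)" using sum_half_up[of "nat l"] l0 by simp
  have "l * l - 4 * (m * (l + k + 1 - m) - k * m) \<le> 4 * (paid n s + needed n r s)"
  proof -
    have "z - 4 * (x - w) \<le> 4 * (p + q)" if "a \<le> p - w + x" "b - a \<le> q" "z \<le> 4 * b"
      for a b p q w x z :: int using that by presburger
    from this[OF 1 2 3] show ?thesis .
  qed
  also have "l * l - 4 * (m * (l + k + 1 - m) - k * m)
      = 4 * (int n * (int n - r) - int n) + r * r + 4 * k"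
    unfolding l_def km[symmetric] by (simp add: algebra_simps)
  finally show ?thesis using k0 by simp
qed

section \<open>Max levels the largest deficits\<close>

definition row :: "nat \<Rightarrow> nat \<Rightarrow> int" where
  "row n j = int n - 1 - int j"

lemma row_Suc: "row n (Suc j) = row n j - 1"
  by (simp add: row_def)

text \<open>
  A sequence of bounds: while Max levels the columns down to row \<open>row n j\<close>, the loss is at most
  what \<open>pace j\<close> clean vertices account for. The step inequality is the one that \<open>paced_next_row\<close>
  asks for, and the slack keeps the water away from the row.
\<close>

locale pacing =
  fixes n :: nat and J :: nat and pace :: "nat \<Rightarrow> real"
  assumes slack: "j \<le> J \<Longrightarrow> 2 * pace j \<le> real_of_int (row n j) - 6"
    and pace_step: "j < J \<Longrightarrow> pace j * (row n j - pace j) + n - 2 * pace j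
      \<le> pace (Suc j) * (row n (Suc j) - pace (Suc j))"
    and pace_0: "pace 0 = 0"
begin

abbreviation on_pace :: "nat \<Rightarrow> real \<Rightarrow> 'a position \<Rightarrow> bool" where
  "on_pace j d s \<equiv> paced n (row n j) (pace j * (row n j - pace j) + d) s"

text \<open>
  Max moves on to lower rows until one of them still has a column to be levelled.
\<close>

lemma drop_empty_rows:
  assumes "finite (fst s)" "j \<le> J" "on_pace j 1 s"
  obtains i where "i \<le> J" "on_pace i 1 s"
    "i = J \<or> low s (row n i - 2 * cleaned n s + 1) \<noteq> card (fst s)"
proof -
  have "\<exists>i\<le>J. on_pace i 1 s \<and> (i = J \<or> low s (row n i - 2 * cleaned n s + 1) \<noteq> card (fst s))"
    using assms(2,3)
  proof (induction j rule: inc_induct)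
    case base
    then show ?case by blast
  next
    case (step j)
    show ?case
    proof (cases "low s (row n j - 2 * cleaned n s + 1) = card (fst s)")
      case True
      have "on_pace (Suc j) 1 s"
        using paced_next_row[OF assms(1) step.prems True] slack[of j] pace_step[of j] step.hyps
        by (simp add: row_Suc)
      then show ?thesis by (rule step.IH)
    next
      case False
      then show ?thesis using step.prems step.hyps by (intro exI[of _ j]) auto
    qed
  qed
  then show thesis using that by blast
qed

text \<open>
  The unit of difference between the two players is the brush that Min may have added before Max
  answers.
\<close>

lemma game_length_ge_on_pace:
  assumes K: "complete_digraph n G" and "fst s \<subseteq> verts G" and "j \<le> J"
  defines "B \<equiv> 4 * (int n * (int n - row n J) - int n) + row n J * row n J"
  shows "on_pace j 0 s \<Longrightarrow> B \<le> 4 * (paid n s + int (game_length G Player_Min s))"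
    and "on_pace j 1 s \<Longrightarrow> B \<le> 4 * (paid n s + int (game_length G Player_Max s))"
proof -
  have "finite (fst s)" using finite_dirty_complete[OF assms(1,2)] by simp
  then have "fst s \<subseteq> verts G \<longrightarrow> (\<forall>j\<le>J.
    (on_pace j 0 s \<longrightarrow> B \<le> 4 * (paid n s + int (game_length G Player_Min s))) \<and>
    (on_pace j 1 s \<longrightarrow> B \<le> 4 * (paid n s + int (game_length G Player_Max s))))"
  proof (induction s rule: play_induct[where G = G])
    case (play s)
    show ?case
    proof (intro impI allI conjI)
      fix j assume D: "fst s \<subseteq> verts G" and j: "j \<le> J"
      have D': "fst (turn G v s) \<subseteq> verts G" for v using turn_complete(1)[OF K D, of v] D by simp
      {
        assume p: "on_pace j 0 s"
        then have "cleaned n s < n" by (auto simp: paced_def row_def)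
        then have "fst s \<noteq> {}" by (auto simp: cleaned_def)
        then obtain v where v: "v \<in> fst s"
          "game_length G Player_Min s = 1 + game_length G Player_Max (turn G v s)"
          using game_length_Min_attained[OF play.hyps] by blast
        have "on_pace j 1 (turn G v s)"
          using paced_turn[OF K D _ _ slack[OF j]] paced_place(1)[OF play.hyps v(1) p] by simp
        then have "B \<le> 4 * (paid n (turn G v s) + int (game_length G Player_Max (turn G v s)))"
          using play.IH[OF v(1)] D' j by blast
        then show "B \<le> 4 * (paid n s + int (game_length G Player_Min s))"
          using paid_turn[OF K D v(1)] v(2) by simp
      next
        assume p: "on_pace j 1 s"
        obtain i where i: "i \<le> J" "on_pace i 1 s"
          "i = J \<or> low s (row n i - 2 * cleaned n s + 1) \<noteq> card (fst s)"
          using drop_empty_rows[OF play.hyps j p] .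
        show "B \<le> 4 * (paid n s + int (game_length G Player_Max s))"
        proof (cases "low s (row n i - 2 * cleaned n s + 1) = card (fst s)")
          case True
          then have "i = J" using i(3) by simp
          then have "B \<le> 4 * (paid n s + needed n (row n J) s)"
            unfolding B_def using paid_needed[OF K D _ True] i(2) by (simp add: paced_def)
          moreover have "needed n (row n J) s \<le> int (game_length G Player_Max s)"
            by (rule game_length_ge_needed[OF K D]) (simp add: row_def)
          ultimately show ?thesis by simp
        next
          case False
          obtain v where v: "v \<in> fst s" "\<not> deficit s v < row n i - 2 * cleaned n s + 1"
          proof (rule ccontr)
            assume "\<not> thesis"
            then have "{v \<in> fst s. deficit s v < row n i - 2 * cleaned n s + 1} = fst s"
              using that by auto
            then show False using False by (simp add: low_def)
          qed
          then have "deficit s v = row n i - 2 * cleaned n s + 1" using i(2) by (force simp: paced_def)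
          then have "on_pace i 0 (turn G v s)"
            using paced_turn[OF K D _ _ slack[OF i(1)]] paced_place(2)[OF play.hyps v(1) i(2)] by simp
          then have "B \<le> 4 * (paid n (turn G v s) + int (game_length G Player_Min (turn G v s)))"
            using play.IH[OF v(1)] D' i(1) by blast
          moreover have "1 + int (game_length G Player_Min (turn G v s)) \<le> int (game_length G Player_Max s)"
            using game_length_Max_ge[OF play.hyps v(1), of G] by linarith
          ultimately show ?thesis using paid_turn[OF K D v(1)] by simp
        qed
      }
    qed
  qed
  then show "on_pace j 0 s \<Longrightarrow> B \<le> 4 * (paid n s + int (game_length G Player_Min s))"
    and "on_pace j 1 s \<Longrightarrow> B \<le> 4 * (paid n s + int (game_length G Player_Max s))"
    using assms by blast+
qed

theorem game_brush_number_ge: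
  assumes K: "complete_digraph n G"
  shows "(real n - row n J / 2)\<^sup>2 - n \<le> b\<^sub>g G"
proof -
  let ?s = "(verts G, \<lambda>_. 0 :: nat)"
  have card: "card (verts G) = n" using K by (simp add: complete_digraph_def)
  have fin: "finite (verts G)" using finite_dirty_complete(1)[OF K, of "verts G"] by simp
  have k: "cleaned n ?s = 0" by (simp add: cleaned_def card)
  have def: "deficit ?s v = int n - 1" for v by (simp add: deficit_def card)
  have "captured ?s (row n 0) = 0"
    unfolding captured_def by (rule sum.neutral) (auto simp: low_def def row_def min_def)
  moreover have "low ?s (row n 0 + 1) = n" by (simp add: low_def def row_def card)
  ultimately have "loss n (row n 0) ?s = 0" by (simp add: loss_def k card)
  then have "on_pace 0 0 ?s" using slack[of 0] by (auto simp: paced_def k def pace_0 row_def)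
  then have "4 * (int n * (int n - row n J) - int n) + row n J * row n J
      \<le> 4 * (paid n ?s + int (game_length G Player_Min ?s))"
    using game_length_ge_on_pace(1)[OF K, of ?s 0] by simp
  also have "paid n ?s = 0" by (simp add: paid_def k)
  finally have "4 * (int n * (int n - row n J) - int n) + row n J * row n J \<le> 4 * int (b\<^sub>g G)"
    by (simp add: game_brush_number_def)
  then have "real_of_int (4 * (int n * (int n - row n J) - int n) + row n J * row n J) \<le> 4 * real (b\<^sub>g G)"
    by linarith
  then show ?thesis by (simp add: power2_eq_square algebra_simps)
qed

end

section \<open>The pace of Max\<close>

text \<open>
  With \<open>u\<close> for \<open>n - pace\<close> and \<open>l\<close> for \<open>row - 2 pace\<close>, the step inequality reads
  \<open>d (l - 1 - d) \<ge> u\<close> for the increment \<open>d\<close> of the pace. The choice \<open>d = u / (l - C)\<close> satisfies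
  it as long as \<open>1 + d \<le> C\<close>, and makes \<open>u\<close> shrink by a factor that depends on \<open>l\<close> only.
\<close>

fun pace :: "real \<Rightarrow> nat \<Rightarrow> nat \<Rightarrow> real" where
  "pace C n 0 = 0"
| "pace C n (Suc j) = pace C n j
    + (real n - pace C n j) / (real_of_int (row n j) - 2 * pace C n j - C)"

text \<open>
  The recursion is followed while \<open>l \<ge> e n\<close>; then \<open>d \<le> 2 / e\<close>, which explains \<open>C\<close>. The bound on
  \<open>n\<close> leaves room for \<open>C\<close> and for one last step below \<open>e n\<close>.
\<close>

locale pace_analysis =
  fixes e :: real and n :: nat and C :: real
  assumes e: "0 < e" "e \<le> 1 / 2" and C: "C = 2 / e + 1" and n: "(2 * C + 5) / e \<le> real n"
begin

abbreviation u :: "nat \<Rightarrow> real" where "u j \<equiv> real n - pace C n j"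
abbreviation l :: "nat \<Rightarrow> real" where "l j \<equiv> real_of_int (row n j) - 2 * pace C n j"
abbreviation th :: "nat \<Rightarrow> real" where "th j \<equiv> 1 / (l j - C)"

lemma C_ge: "5 \<le> C"
  using e unfolding C by (simp add: field_simps)

lemma en: "2 * C + 5 \<le> e * n"
  using n e by (simp add: field_simps)

lemma n_ge: "30 \<le> real n"
proof -
  have "e * n \<le> (1 / 2) * n" using e by (intro mult_right_mono) auto
  then show ?thesis using en C_ge by simp
qed

lemma u_Suc: "u (Suc j) = u j * (1 - th j)"
  by (simp add: algebra_simps)

lemma l_Suc: "l (Suc j) = l j - 1 - 2 * (u j * th j)"
  by (simp add: row_Suc algebra_simps)

lemma gap:
  assumes "e * n \<le> l j"
  shows "e * n / 2 \<le> l j - C" "0 < l j - C"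
  using en assms C_ge by auto

lemma th_bounds:
  assumes "e * n \<le> l j"
  shows "0 < th j" "th j \<le> 2 / (e * n)" "th j \<le> 1 / 2"
proof -
  have en0: "0 < e * n" using en C_ge by linarith
  show "0 < th j" using gap[OF assms] by simp
  have "1 / (l j - C) \<le> 1 / (e * n / 2)"
    using gap[OF assms] en0 by (intro divide_left_mono mult_pos_pos) auto
  then show 1: "th j \<le> 2 / (e * n)" by simp
  have "2 / (e * n) \<le> 1 / 2" using en C_ge by (simp add: divide_simps)
  with 1 show "th j \<le> 1 / 2" by simp
qed

lemma pace_nonneg:
  assumes "\<And>i. i < j \<Longrightarrow> e * n \<le> l i"
  shows "0 \<le> pace C n j \<and> pace C n j \<le> n"
  using assms
proof (induction j)
  case (Suc j)
  then have IH: "0 \<le> pace C n j" "0 \<le> u j" by auto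
  have th: "0 < th j" "th j \<le> 1 / 2" using th_bounds[OF Suc.prems[of j]] by auto
  have "0 \<le> u j * th j" "u j * th j \<le> u j"
    using IH th mult_left_mono[of "th j" 1 "u j"] by (auto simp del: times_divide_eq_right)
  then show ?case using IH by simp
qed simp

lemma u_bounds:
  assumes "\<And>i. i < j \<Longrightarrow> e * n \<le> l i" "0 \<le> l j"
  shows "real n / 2 \<le> u j" "u j \<le> n"
proof -
  have "real_of_int (row n j) \<le> real n" by (simp add: row_def)
  then show "real n / 2 \<le> u j" using assms(2) by linarith
  show "u j \<le> n" using pace_nonneg[OF assms(1)] by simp
qed

lemma step_le:
  assumes "\<And>i. i \<le> j \<Longrightarrow> e * n \<le> l i"
  shows "0 \<le> u j * th j" "u j * th j \<le> C - 1"
proof -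
  have l: "e * n \<le> l j" "0 \<le> l j" using assms[of j] en C_ge by auto
  have u: "real n / 2 \<le> u j" "u j \<le> n" using u_bounds[of j] assms l by auto
  show "0 \<le> u j * th j" using u th_bounds(1)[OF l(1)] by (intro mult_nonneg_nonneg) auto
  have "u j * th j \<le> n * (2 / (e * n))"
    using u th_bounds[OF l(1)] by (intro mult_mono) auto
  also have "\<dots> = C - 1" using n_ge by (simp add: C)
  finally show "u j * th j \<le> C - 1" .
qed

lemma pace_step:
  assumes "\<And>i. i \<le> j \<Longrightarrow> e * n \<le> l i"
  shows "pace C n j * (row n j - pace C n j) + n - 2 * pace C n j
      \<le> pace C n (Suc j) * (row n (Suc j) - pace C n (Suc j))"
proof -
  define k where "k = pace C n j"
  define r where "r = real_of_int (row n j)"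
  define d where "d = u j * th j"
  have k': "pace C n (Suc j) = k + d" by (simp add: d_def k_def)
  have r': "real_of_int (row n (Suc j)) = r - 1" by (simp add: r_def row_Suc)
  have "d * (l j - C) = u j" using gap(2)[OF assms[of j]] by (simp add: d_def)
  moreover have "d * (l j - C) \<le> d * (l j - 1 - d)"
    using step_le[of j, OF assms] unfolding d_def by (intro mult_left_mono) linarith+
  ultimately have "n - k \<le> d * (r - 2 * k - 1 - d)" by (simp add: k_def r_def)
  then show ?thesis
    unfolding k' r' k_def[symmetric] r_def[symmetric] by (simp add: algebra_simps)
qed

text \<open>
  The invariant of the differential equation.
\<close>

definition Q :: "nat \<Rightarrow> real" where
  "Q j = 2 * ln (u j) - l j / u j"

text \<open>
  The constant \<open>C\<close> and the discretization are lower order terms: the invariant loses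
  \<open>O(1 / n\<^sup>2)\<close> per row, hence \<open>O(1 / n)\<close> over all rows.
\<close>

lemma Q_step:
  assumes "\<And>i. i \<le> j \<Longrightarrow> e * n \<le> l i"
  shows "Q j - 8 * C / (e * (real n)\<^sup>2) \<le> Q (Suc j)"
proof -
  have lj: "e * n \<le> l j" "0 \<le> l j" using assms[of j] en C_ge by auto
  have u: "real n / 2 \<le> u j" using u_bounds[of j] assms lj by auto
  then have u0: "0 < u j" using n_ge by simp
  note th = th_bounds[OF lj(1)]
  have en0: "0 < e * n" using en C_ge by linarith
  have thC: "th j * (l j - C) = 1" using gap(2)[OF lj(1)] by simp
  have "- (th j / (1 - th j)) \<le> ln (1 - th j)"
  proof -
    have "ln (1 / (1 - th j)) \<le> 1 / (1 - th j) - 1" using th by (intro ln_le_minus_one) auto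
    also have "1 / (1 - th j) - 1 = th j / (1 - th j)" using th by (simp add: field_simps)
    finally show ?thesis using th by (simp add: ln_div)
  qed
  then have 1: "2 * ln (u j) - 2 * (th j / (1 - th j)) \<le> 2 * ln (u (Suc j))"
    unfolding u_Suc using th u0 by (simp add: ln_mult)
  have 2: "l j / u j - l (Suc j) / u (Suc j)
      = 2 * (th j / (1 - th j)) - C * th j / (u j * (1 - th j))"
  proof -
    define w x y where "w = u j" and "x = l j" and "y = th j"
    have t: "y * (x - C) = 1" unfolding x_def y_def by (rule thC)
    have nz: "w \<noteq> 0" "1 - y \<noteq> 0" using u0 th unfolding w_def y_def by auto
    have "x / w - (x - 1 - 2 * (w * y)) / (w * (1 - y))
        = (x * (1 - y) - (x - 1 - 2 * (w * y))) / (w * (1 - y))"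
      using nz by (simp add: diff_divide_distrib)
    also have "x * (1 - y) - (x - 1 - 2 * (w * y)) = 2 * (w * y) - C * y"
      using t by (simp add: algebra_simps)
    also have "(2 * (w * y) - C * y) / (w * (1 - y)) = 2 * (y / (1 - y)) - C * y / (w * (1 - y))"
      using nz by (simp add: diff_divide_distrib)
    finally show ?thesis unfolding u_Suc l_Suc w_def x_def y_def .
  qed
  have "C * th j / (u j * (1 - th j)) \<le> C * (2 / (e * n)) / (real n / 2 * (1 / 2))"
  proof (rule frac_le)
    show "C * th j \<le> C * (2 / (e * n))" using th(2) C_ge by (intro mult_left_mono) linarith+
    show "real n / 2 * (1 / 2) \<le> u j * (1 - th j)"
      using u u0 th(3) by (intro mult_mono) linarith+
  qed (use C_ge en0 e n_ge in auto)
  also have "\<dots> = 8 * C / (e * (real n)\<^sup>2)" by (simp add: power2_eq_square)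
  finally show ?thesis using 1 2 unfolding Q_def by linarith
qed

lemma Q_ge:
  assumes "\<And>i. i < j \<Longrightarrow> e * n \<le> l i"
  shows "2 * ln (real n) - 1 - j * (8 * C / (e * (real n)\<^sup>2)) \<le> Q j"
  using assms
proof (induction j)
  case 0
  have "real_of_int (row n 0) / real n \<le> 1" using n_ge by (simp add: row_def)
  then show ?case by (simp add: Q_def)
next
  case (Suc j)
  define K where "K = 8 * C / (e * (real n)\<^sup>2)"
  have "Q j - K \<le> Q (Suc j)" unfolding K_def by (rule Q_step) (use Suc.prems in simp)
  moreover have "2 * ln (real n) - 1 - j * K \<le> Q j"
    unfolding K_def by (rule Suc.IH) (use Suc.prems in simp)
  moreover have "real (Suc j) * K = j * K + K" by (simp add: algebra_simps)
  ultimately show ?case unfolding K_def[symmetric] by linarith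
qed

text \<open>
  At the first row with \<open>l < e n\<close> the invariant still is about \<open>2 ln n - 1\<close>, so \<open>u\<close> is about
  \<open>n exp (- 1 / 2)\<close>, and the quantity \<open>n - row / 2\<close> that determines the length of the game is
  \<open>u - l / 2\<close>.
\<close>

theorem pacing_exists:
  obtains J where "pacing n J (pace C n)"
    and "n * (exp (- (1 / 2) - 4 * C / (e * n)) - e / 2) \<le> n - row n J / 2"
proof -
  obtain j0 where j0: "j0 \<le> n" "l j0 < e * n"
  proof (rule ccontr)
    assume "\<not> thesis"
    then have none: "\<not> (i \<le> n \<and> l i < e * n)" for i using that by blast
    have all: "e * n \<le> l i" if "i \<le> n" for i using none[of i] that by linarith
    then have "0 \<le> pace C n n" using pace_nonneg[of n] by simp
    moreover have "e * n \<le> l n" using all by simp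
    ultimately show False using en C_ge by (simp add: row_def)
  qed
  define J where "J = (LEAST j. l j < e * n)"
  have J: "l J < e * n" unfolding J_def by (rule LeastI[of "\<lambda>j. l j < e * n", OF j0(2)])
  have Jn: "J \<le> n"
    unfolding J_def by (rule order_trans[OF Least_le[of "\<lambda>j. l j < e * n", OF j0(2)] j0(1)])
  have below: "e * n \<le> l i" if "i < J" for i
    using not_less_Least[of i "\<lambda>j. l j < e * n"] that unfolding J_def by linarith
  have J0: "J \<noteq> 0"
  proof
    assume "J = 0"
    then have "real n - 1 < e * n" using J by (simp add: row_def)
    also have "e * n \<le> (1 / 2) * n" using e by (intro mult_right_mono) auto
    finally show False using n_ge by simp
  qed
  then obtain i where i: "J = Suc i" using not0_implies_Suc by blast
  have lJ: "6 \<le> l J"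
  proof -
    have "u i * th i \<le> C - 1" using step_le(2)[of i] below i by simp
    moreover have "l J = l i - 1 - 2 * (u i * th i)" unfolding i by (rule l_Suc)
    ultimately show ?thesis using below[of i] i en by linarith
  qed
  have slack: "6 \<le> l j" if "j \<le> J" for j
    using that lJ below[of j] en C_ge by (cases "j = J") auto
  have pac: "pacing n J (pace C n)"
  proof
    fix j
    show "j \<le> J \<Longrightarrow> 2 * pace C n j \<le> real_of_int (row n j) - 6" using slack[of j] by simp
    show "j < J \<Longrightarrow> pace C n j * (row n j - pace C n j) + n - 2 * pace C n j
      \<le> pace C n (Suc j) * (row n (Suc j) - pace C n (Suc j))"
      by (rule pace_step) (use below in simp)
  qed simp
  have u: "real n / 2 \<le> u J" using u_bounds[of J] below lJ by auto
  then have u0: "0 < u J" using n_ge by simp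
  have "2 * ln (real n) - 1 - J * (8 * C / (e * (real n)\<^sup>2)) \<le> 2 * ln (u J)"
  proof -
    have "0 \<le> l J / u J" using lJ u0 by simp
    then show ?thesis using Q_ge[of J] below by (simp add: Q_def)
  qed
  moreover have "J * (8 * C / (e * (real n)\<^sup>2)) \<le> n * (8 * C / (e * (real n)\<^sup>2))"
    using Jn C_ge e by (intro mult_right_mono) auto
  moreover have "n * (8 * C / (e * (real n)\<^sup>2)) = 2 * (4 * C / (e * n))"
    using n_ge by (simp add: power2_eq_square)
  ultimately have "ln (real n) + (- (1 / 2) - 4 * C / (e * n)) \<le> ln (u J)" by linarith
  then have "exp (ln (real n) + (- (1 / 2) - 4 * C / (e * n))) \<le> exp (ln (u J))"
    by (simp only: exp_le_cancel_iff)
  moreover have "exp (ln (u J)) = u J" using u0 by (rule exp_ln)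
  moreover have "exp (ln (real n) + (- (1 / 2) - 4 * C / (e * n)))
      = n * exp (- (1 / 2) - 4 * C / (e * n))"
    unfolding exp_add using n_ge by simp
  ultimately have "n * exp (- (1 / 2) - 4 * C / (e * n)) \<le> u J" by simp
  moreover have "n - row n J / 2 = u J - l J / 2" by (simp add: field_simps)
  moreover have "n * (e / 2) = e * n / 2" by simp
  ultimately have "n * (exp (- (1 / 2) - 4 * C / (e * n)) - e / 2) \<le> n - row n J / 2"
    using J unfolding right_diff_distrib by linarith
  with pac show thesis by (rule that)
qed

end

section \<open>The asymptotic length\<close>

lemma game_brush_number_lower:
  assumes K: "complete_digraph n G" and e: "0 < e" "e \<le> 1 / 2" and C: "C = 2 / e + 1"
    and n: "(2 * C + 5) / e \<le> real n" and pos: "e / 2 \<le> exp (- (1 / 2) - 4 * C / (e * n))"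
  shows "(real n)\<^sup>2 * (exp (- (1 / 2) - 4 * C / (e * n)) - e / 2)\<^sup>2 - n \<le> b\<^sub>g G"
proof -
  interpret pace_analysis e n C using e C n by unfold_locales
  obtain J where J: "pacing n J (pace C n)"
    "n * (exp (- (1 / 2) - 4 * C / (e * n)) - e / 2) \<le> n - row n J / 2"
    by (rule pacing_exists)
  have "(n * (exp (- (1 / 2) - 4 * C / (e * n)) - e / 2))\<^sup>2 \<le> (n - row n J / 2)\<^sup>2"
    using J(2) pos by (intro power_mono mult_nonneg_nonneg) auto
  then show ?thesis
    using pacing.game_brush_number_ge[OF J(1) K] by (simp add: power_mult_distrib)
qed

lemma eventually_game_brush_number_gt:
  fixes G :: "nat \<Rightarrow> ('a, 'b) pre_digraph"
  assumes K: "\<And>n. complete_digraph n (G n)" and a: "a < exp (- 1)"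
  shows "\<forall>\<^sub>F n in sequentially. a < b\<^sub>g (G n) / (real n)\<^sup>2"
proof -
  have "((\<lambda>e. (exp (- (1 / 2)) - e / 2)\<^sup>2) \<longlongrightarrow> (exp (- (1 / 2)) - 0 / 2)\<^sup>2) (at_right (0 :: real))"
    by (intro tendsto_intros) auto
  moreover have "(exp (- (1 / 2)) - 0 / 2)\<^sup>2 = exp (- 1 :: real)"
    by (simp add: power2_eq_square flip: exp_add)
  ultimately have "\<forall>\<^sub>F e in at_right 0. a < (exp (- (1 / 2)) - e / 2)\<^sup>2"
    using a by (simp add: order_tendstoD(1))
  moreover have "\<forall>\<^sub>F e in at_right 0. e / 2 < exp (- (1 / 2) :: real)"
  proof (rule order_tendstoD(2))
    show "((\<lambda>e. e / 2) \<longlongrightarrow> 0 / 2) (at_right (0 :: real))" by (intro tendsto_intros) auto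
  qed simp
  moreover have "\<forall>\<^sub>F e in at_right 0. (e :: real) \<in> {0<..<1 / 2}"
    by (rule eventually_at_right_real) simp
  ultimately have "\<forall>\<^sub>F e in at_right 0. a < (exp (- (1 / 2)) - e / 2)\<^sup>2 \<and>
      e / 2 < exp (- (1 / 2)) \<and> e \<in> {0<..<1 / 2 :: real}"
    by eventually_elim auto
  then obtain e :: real where e: "a < (exp (- (1 / 2)) - e / 2)\<^sup>2" "e / 2 < exp (- (1 / 2))"
    "0 < e" "e < 1 / 2"
    using eventually_happens'[OF trivial_limit_at_right_real] by auto
  define C where "C = 2 / e + 1"
  let ?x = "\<lambda>n. exp (- (1 / 2) - 4 * C / (e * real n))"
  have "(\<lambda>n. exp (- (1 / 2) - (4 * C / e) / real n)) \<longlonglongrightarrow> exp (- (1 / 2) - 0)"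
    by (intro tendsto_intros lim_const_over_n)
  then have x: "?x \<longlonglongrightarrow> exp (- (1 / 2))" by simp
  have "(\<lambda>n. (?x n - e / 2)\<^sup>2 - 1 / real n) \<longlonglongrightarrow> (exp (- (1 / 2)) - e / 2)\<^sup>2 - 0"
    by (intro tendsto_intros x lim_1_over_n)
  then have "\<forall>\<^sub>F n in sequentially. a < (?x n - e / 2)\<^sup>2 - 1 / real n"
    by (rule order_tendstoD(1)) (use e in simp)
  moreover have "\<forall>\<^sub>F n in sequentially. e / 2 < ?x n" by (rule order_tendstoD(1)[OF x e(2)])
  moreover have "\<forall>\<^sub>F n in sequentially. (2 * C + 5) / e \<le> real n"
    using filterlim_real_sequentially unfolding filterlim_at_top by blast
  moreover have "\<forall>\<^sub>F n in sequentially. 0 < n" by (rule eventually_gt_at_top)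
  ultimately show ?thesis
  proof eventually_elim
    case (elim n)
    have "(real n)\<^sup>2 * ((?x n - e / 2)\<^sup>2 - 1 / n) \<le> b\<^sub>g (G n)"
      using game_brush_number_lower[OF K e(3) _ C_def, of n] elim e(4)
      by (simp add: algebra_simps power2_eq_square)
    then have "(?x n - e / 2)\<^sup>2 - 1 / n \<le> b\<^sub>g (G n) / (real n)\<^sup>2"
      using elim by (simp add: field_simps)
    then show ?case using elim by linarith
  qed
qed

theorem theorem4:
  fixes G :: "nat \<Rightarrow> ('a, 'b) pre_digraph"
  assumes "\<And>n. complete_digraph n (G n)"
  shows "(\<lambda>n. real (b\<^sub>g (G n))) \<sim>[at_top] (\<lambda>n. (real n)\<^sup>2 / exp 1)"
proof -
  have "(\<lambda>n. b\<^sub>g (G n) / (real n)\<^sup>2) \<longlonglongrightarrow> exp (- 1)"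
  proof (rule order_tendstoI)
    fix a :: real assume "a < exp (- 1)"
    then show "\<forall>\<^sub>F n in sequentially. a < b\<^sub>g (G n) / (real n)\<^sup>2"
      by (rule eventually_game_brush_number_gt[OF assms])
  next
    fix a :: real assume a: "exp (- 1) < a"
    have "(\<lambda>n. exp (- 1) + 10 / real n + 8 / real n * (1 / real n)) \<longlonglongrightarrow> exp (- 1) + 0 + 0 * 0"
      by (intro tendsto_intros lim_const_over_n lim_1_over_n)
    then have "(\<lambda>n. exp (- 1) + 10 / real n + 8 / (real n)\<^sup>2) \<longlonglongrightarrow> exp (- 1)"
      by (simp add: power2_eq_square)
    then have "\<forall>\<^sub>F n in sequentially. exp (- 1) + 10 / real n + 8 / (real n)\<^sup>2 < a"
      using a by (rule order_tendstoD(2))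
    moreover have "\<forall>\<^sub>F n in sequentially. 2 \<le> n" by (rule eventually_ge_at_top)
    ultimately show "\<forall>\<^sub>F n in sequentially. b\<^sub>g (G n) / (real n)\<^sup>2 < a"
    proof eventually_elim
      case (elim n)
      have "b\<^sub>g (G n) / (real n)\<^sup>2 \<le> ((real n)\<^sup>2 / exp 1 + 10 * n + 8) / (real n)\<^sup>2"
        using game_brush_number_complete_le[OF assms elim(2)] by (simp add: divide_right_mono)
      also have "\<dots> = exp (- 1) + 10 / real n + 8 / (real n)\<^sup>2"
        using elim by (simp add: add_divide_distrib exp_minus inverse_eq_divide power2_eq_square)
      finally show ?case using elim by simp
    qed
  qed
  then have "(\<lambda>n. b\<^sub>g (G n) / (real n)\<^sup>2 * exp 1) \<longlonglongrightarrow> exp (- 1) * exp 1"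
    by (intro tendsto_intros)
  then have "(\<lambda>n. b\<^sub>g (G n) / ((real n)\<^sup>2 / exp 1)) \<longlonglongrightarrow> 1"
    by (simp flip: exp_add)
  then show ?thesis
    by (rule asymp_equivI'_const[where c = 1, simplified])
qed

end
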